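(* Let $q > 4\cdot 10^5$ be an integer and let $\chi$ be an even non-principal real Dirichlet character modulo $q$. If $\beta_0\in(0,1)$ is a real zero of $L(s,\chi)$, then $$\beta_0 \leq 1-\frac{100}{\sqrt{q}\log^2 q} .$$
   Context: A Dirichlet character $\chi$ is even if $\chi(-1)=1$, and real if it takes only real values; $\chi$ is not assumed primitive. For a non-principal Dirichlet character $\chi$ and $\Re(s)>0$, $L(s,\chi)=\sum_{n=1}^{\infty}\chi(n)n^{-s}$ (a convergent, in general conditionally convergent, series). $\log$ is the natural logarithm and $\log^2 q=(\log q)^2$. *)

theory Defs
  imports "HOL-Analysis.Analysis"
begin

text \<open>Characters are functions on all integers, so that \<open>chi (-1)\<close> is meaningful.
  The value \<open>chi 1 = 1\<close> follows from multiplicativity and \<open>chi 1 \<noteq> 0\<close>.\<close>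

definition dirichlet_character :: "nat \<Rightarrow> (int \<Rightarrow> complex) \<Rightarrow> bool" where
  "dirichlet_character q chi \<longleftrightarrow>
     q > 0 \<and>
     (\<forall>n. chi (n + int q) = chi n) \<and>
     (\<forall>m n. chi (m * n) = chi m * chi n) \<and>
     (\<forall>n. chi n = 0 \<longleftrightarrow> \<not> coprime n (int q))"

definition principal_character :: "nat \<Rightarrow> int \<Rightarrow> complex" where
  "principal_character q n = (if coprime n (int q) then 1 else 0)"

definition even_character :: "(int \<Rightarrow> complex) \<Rightarrow> bool" where
  "even_character chi \<longleftrightarrow> chi (-1) = 1"

definition real_character :: "(int \<Rightarrow> complex) \<Rightarrow> bool" where
  "real_character chi \<longleftrightarrow> (\<forall>n. chi n \<in> \<real>)"

text \<open>The term with index \<open>k\<close> belongs to \<open>n = k + 1\<close>. The sum is the limit of the partial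
  sums in their natural order, so conditional convergence is covered. For non-principal
  \<open>chi\<close> the series converges if \<open>Re s > 0\<close>; only there is \<open>dirichlet_L\<close> the
  \<open>L\<close>-function, since the definition involves no analytic continuation.\<close>

definition dirichlet_L :: "complex \<Rightarrow> (int \<Rightarrow> complex) \<Rightarrow> complex" where
  "dirichlet_L s chi = (\<Sum>k. chi (int (Suc k)) * of_nat (Suc k) powr (- s))"

end

theory Submission
  imports Defs "HOL-Number_Theory.Number_Theory" "HOL-Computational_Algebra.Polynomial"
begin

text \<open>Let \<open>\<psi>\<close> be the primitive character modulo \<open>d\<close> that induces \<open>chi\<close>, let \<open>\<beta>\<close> be the zero
  and \<open>\<delta> = 1 - \<beta>\<close>. Then \<open>- L(1,\<psi>)\<close> is the sum of \<open>\<psi>(n) f(n)\<close>, where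
  \<open>f(n) = n powr (- \<beta>) - 1 / n\<close> is about \<open>\<delta> ln n / n\<close>.

  Upper bound. Expanding \<open>\<psi>(i - j)\<close> into additive characters, summed over \<open>i, j < N\<close>, shows that
  the sum of \<open>(N - k) \<psi>(k)\<close> over \<open>k < N\<close> is at most \<open>N sqrt d / 2\<close>. Two summations by parts
  turn this into a bound for the sum of \<open>\<psi>(n) h(n)\<close> with \<open>h\<close> convex. Taking \<open>h = f\<close> beyond
  \<open>m \<ge> sqrt d\<close>, continued linearly below \<open>m\<close>, and estimating the remaining terms \<open>n < m\<close> trivially
  gives \<open>\<bar>L(1,\<psi>)\<bar> \<le> \<delta> (l^2 / 8 - l / 4 + O(1))\<close> with \<open>l = ln d\<close>.

  Lower bound. By the logarithmic series, \<open>sqrt d \<bar>L(1,\<psi>)\<bar> = \<bar>ln (P / Q)\<bar>\<close>, where \<open>P\<close> and \<open>Q\<close> are the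
  products of \<open>\<bar>1 - \<zeta>^a\<bar>\<close> over the \<open>a\<close> with \<open>\<psi>(a) = 1\<close> and \<open>\<psi>(a) = -1\<close>, for a primitive \<open>d\<close>-th root
  of unity \<open>\<zeta>\<close>. Expanding the product, \<open>(P - Q)^2 = d y^2\<close> with an integer \<open>y\<close>, which is nonzero
  because \<open>L(1,\<psi>)\<close> is; moreover \<open>P Q = 1\<close> unless \<open>d\<close> is \<open>8\<close> or a prime, and if \<open>d\<close> is prime, then \<open>P Q = d\<close>
  and \<open>P + Q\<close> is a multiple of \<open>d\<close>. In all cases \<open>P / Q + Q / P \<ge> d - 2\<close>,
  so \<open>sqrt d \<bar>L(1,\<psi>)\<bar> \<ge> ln (d - 3)\<close>.\<close>

section \<open>Summation by parts\<close>

lemma summation_by_parts: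
  fixes c f :: "nat \<Rightarrow> real"
  shows "(\<Sum>k<N. c k * f k) = sum c {..<N} * f N + (\<Sum>k<N. sum c {..<Suc k} * (f k - f (Suc k)))"
  by (induction N) (simp_all add: algebra_simps)

text \<open>Abel's inequality: the weights \<open>f k - f (Suc k)\<close> and \<open>f N\<close>
  left by summation by parts are nonnegative and telescope to \<open>f 0\<close>.\<close>

lemma sum_decseq_weighted_le:
  fixes c f :: "nat \<Rightarrow> real"
  assumes A: "\<And>N. \<bar>sum c {..<N}\<bar> \<le> C" and f: "decseq f" "\<And>n. 0 \<le> f n"
  shows "\<bar>\<Sum>k<N. c k * f k\<bar> \<le> C * f 0"
proof -
  have d: "f k - f (Suc k) \<ge> 0" for k using f(1) by (simp add: decseq_Suc_iff)
  have "\<bar>\<Sum>k<N. c k * f k\<bar> \<le> \<bar>sum c {..<N} * f N\<bar> + \<bar>\<Sum>k<N. sum c {..<Suc k} * (f k - f (Suc k))\<bar>"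
    unfolding summation_by_parts[of c f] by (rule abs_triangle_ineq)
  also have "\<dots> \<le> C * f N + (\<Sum>k<N. \<bar>sum c {..<Suc k} * (f k - f (Suc k))\<bar>)"
    by (intro add_mono sum_abs) (use A f(2) in \<open>simp add: abs_mult mult_right_mono\<close>)
  also have "\<dots> \<le> C * f N + (\<Sum>k<N. C * (f k - f (Suc k)))"
    by (intro add_left_mono sum_mono) (use A d in \<open>simp add: abs_mult mult_right_mono del: sum.lessThan_Suc\<close>)
  also have "\<dots> = C * f 0"
    by (simp only: sum_distrib_left [symmetric] sum_lessThan_telescope') (simp add: algebra_simps)
  finally show ?thesis .
qed

lemma dirichlet_test:
  fixes c f :: "nat \<Rightarrow> real"
  assumes A: "\<And>N. \<bar>sum c {..<N}\<bar> \<le> C" and f: "decseq f" "f \<longlonglongrightarrow> 0"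
  shows "summable (\<lambda>k. c k * f k)" "\<bar>\<Sum>k. c k * f k\<bar> \<le> C * f 0"
proof -
  have d: "f k - f (Suc k) \<ge> 0" for k using f(1) by (simp add: decseq_Suc_iff)
  have f0: "f n \<ge> 0" for n using decseq_ge[OF f] .
  have C: "C \<ge> 0" using A[of 0] by simp
  have s: "summable (\<lambda>k. C * (f k - f (Suc k)))"
    using telescope_summable'[OF f(2)] by (rule summable_mult)
  have "summable (\<lambda>k. sum c {..<Suc k} * (f k - f (Suc k)))"
    by (rule summable_comparison_test'[OF s, of 0])
       (use A d in \<open>simp add: abs_mult mult_right_mono del: sum.lessThan_Suc\<close>)
  hence "convergent (\<lambda>N. \<Sum>k<N. sum c {..<Suc k} * (f k - f (Suc k)))"
    by (simp add: summable_iff_convergent)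
  moreover have "(\<lambda>N. sum c {..<N} * f N) \<longlonglongrightarrow> 0"
    by (rule Lim_null_comparison[of _ "\<lambda>N. C * f N"])
       (use A f0 in \<open>auto simp: abs_mult mult_right_mono intro!: tendsto_mult_right_zero f\<close>)
  hence "convergent (\<lambda>N. sum c {..<N} * f N)" by (auto simp: convergent_def)
  ultimately show S: "summable (\<lambda>k. c k * f k)"
    unfolding summable_iff_convergent summation_by_parts[of c f] by (intro convergent_add)
  show "\<bar>\<Sum>k. c k * f k\<bar> \<le> C * f 0"
    by (rule Lim_bounded[OF tendsto_rabs[OF summable_LIMSEQ[OF S]]])
       (use sum_decseq_weighted_le[OF A f(1) f0] in auto)
qed

text \<open>A second summation by parts, of the partial sums of \<open>c\<close> against the first
  differences of \<open>f\<close>. Convexity makes the second differences nonnegative, so the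
  constant in the result comes from the averaged bound \<open>w\<close>, while \<open>C\<close>
  secures convergence.\<close>

lemma convex_weighted_sum_le:
  fixes c f :: "nat \<Rightarrow> real"
  assumes A: "\<And>N. \<bar>sum c {..<N}\<bar> \<le> C"
    and B: "\<And>N. \<bar>\<Sum>n<N. sum c {..<Suc n}\<bar> \<le> w * real N"
    and f: "decseq f" "f \<longlonglongrightarrow> 0"
    and conv: "\<And>n. f (Suc n) - f (Suc (Suc n)) \<le> f n - f (Suc n)"
  shows "\<bar>\<Sum>k. c k * f k\<bar> \<le> w * f 0"
proof -
  define D where "D n = f n - f (Suc n)" for n
  define E where "E n = sum c {..<Suc n}" for n
  have D0: "D k \<ge> 0" for k using f(1) by (simp add: decseq_Suc_iff D_def)
  have Dd: "D k - D (Suc k) \<ge> 0" for k using conv[of k] by (simp add: D_def)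
  have w: "w \<ge> 0" using B[of 1] by auto
  have f0: "f n \<ge> 0" for n using decseq_ge[OF f] .
  have bound: "\<bar>\<Sum>k<N. E k * D k\<bar> \<le> w * f 0" for N
  proof -
    have "\<bar>\<Sum>k<N. E k * D k\<bar> \<le> \<bar>sum E {..<N} * D N\<bar> + \<bar>\<Sum>k<N. sum E {..<Suc k} * (D k - D (Suc k))\<bar>"
      unfolding summation_by_parts[of E D] by (rule abs_triangle_ineq)
    also have "\<dots> \<le> w * real N * D N + (\<Sum>k<N. \<bar>sum E {..<Suc k} * (D k - D (Suc k))\<bar>)"
      using B[of N] D0[of N]
      by (intro add_mono sum_abs) (simp add: abs_mult mult_right_mono E_def del: sum.lessThan_Suc)
    also have "\<dots> \<le> w * real N * D N + (\<Sum>k<N. w * real (Suc k) * (D k - D (Suc k)))"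
    proof (intro add_left_mono sum_mono)
      fix k
      have "\<bar>sum E {..<Suc k}\<bar> \<le> w * real (Suc k)" using B[of "Suc k"] unfolding E_def .
      thus "\<bar>sum E {..<Suc k} * (D k - D (Suc k))\<bar> \<le> w * real (Suc k) * (D k - D (Suc k))"
        using Dd[of k] by (simp add: abs_mult mult_right_mono del: sum.lessThan_Suc)
    qed
    \<comment> \<open>Summation by parts read backwards, for the constant sequence
      \<open>w\<close>.\<close>
    also have "\<dots> = w * (\<Sum>k<N. D k)" by (induction N) (simp_all add: algebra_simps)
    also have "(\<Sum>k<N. D k) = f 0 - f N" unfolding D_def by (rule sum_lessThan_telescope')
    also have "w * (f 0 - f N) \<le> w * f 0" using w f0[of N] by (simp add: mult_left_mono)
    finally show ?thesis .
  qed
  have S: "summable (\<lambda>k. c k * f k)" by (rule dirichlet_test[OF A f])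
  have "(\<lambda>N. sum c {..<N} * f N) \<longlonglongrightarrow> 0"
    by (rule Lim_null_comparison[of _ "\<lambda>N. C * f N"])
       (use A f0 in \<open>auto simp: abs_mult mult_right_mono intro!: tendsto_mult_right_zero f\<close>)
  from tendsto_diff[OF summable_LIMSEQ[OF S] this]
  have "(\<lambda>N. \<Sum>k<N. E k * D k) \<longlonglongrightarrow> (\<Sum>k. c k * f k)"
    unfolding summation_by_parts[of c f] D_def E_def by simp
  from tendsto_rabs[OF this] show ?thesis
    by (rule Lim_bounded) (use bound in auto)
qed

section \<open>The weight and its truncated sum\<close>

text \<open>With \<open>\<delta> = 1 - \<beta>\<close> and \<open>x > 0\<close> this is the weight
  \<open>x powr (- \<beta>) - 1 / x\<close>; the quotient form makes it visible that
  \<open>x * pdiff \<delta> x\<close> increases.\<close>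

definition pdiff :: "real \<Rightarrow> real \<Rightarrow> real" where
  "pdiff \<delta> x = (x powr \<delta> - 1) / x"

text \<open>What counts is that \<open>8 / 5\<close> exceeds \<open>3 / 2\<close>: for small
  \<delta> the weight is convex about where \<open>ln x > 3 / 2\<close>, so 5 is the first integer
  at which convexity can be used.\<close>

lemma ln_5_ge: "8 / 5 \<le> ln (5::real)"
proof -
  have "exp (8::real) = exp 1 ^ (8::nat)" by (simp flip: exp_of_nat_mult)
  also have "\<dots> \<le> (272 / 100) ^ (8::nat)" by (intro power_mono) (use e_less_272 in auto)
  also have "\<dots> \<le> 5 ^ (5::nat)" by (simp add: power_divide)
  finally have "8 \<le> ln (5 ^ (5::nat) :: real)" by (subst ln_ge_iff) auto
  moreover have "ln (5 ^ (5::nat) :: real) = 5 * ln 5" by (subst ln_realpow) auto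
  ultimately show ?thesis by linarith
qed

lemma pdiff_ge:
  assumes "0 \<le> \<delta>" "1 \<le> x"
  shows "\<delta> * ln x / x \<le> pdiff \<delta> x"
proof -
  have "1 + \<delta> * ln x \<le> x powr \<delta>"
    using exp_ge_add_one_self[of "\<delta> * ln x"] assms by (simp add: powr_def)
  thus ?thesis using assms by (simp add: pdiff_def divide_right_mono)
qed

lemma pdiff_nonneg: "0 \<le> \<delta> \<Longrightarrow> 1 \<le> x \<Longrightarrow> 0 \<le> pdiff \<delta> x"
  using pdiff_ge[of \<delta> x] by (smt (verit) divide_nonneg_nonneg ln_ge_zero mult_nonneg_nonneg)

lemma pdiff_le:
  assumes "0 \<le> \<delta>" "1 \<le> x"
  shows "pdiff \<delta> x \<le> \<delta> * x powr \<delta> * ln x / x"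
proof -
  have "1 - \<delta> * ln x \<le> exp (- (\<delta> * ln x))" using exp_ge_add_one_self[of "- (\<delta> * ln x)"] by simp
  hence "(1 - \<delta> * ln x) * exp (\<delta> * ln x) \<le> exp (- (\<delta> * ln x)) * exp (\<delta> * ln x)"
    by (intro mult_right_mono) auto
  hence "x powr \<delta> - 1 \<le> \<delta> * x powr \<delta> * ln x"
    using assms by (simp add: powr_def algebra_simps flip: exp_add)
  thus ?thesis using assms by (simp add: pdiff_def divide_right_mono)
qed

lemma pdiff_eq: "0 < x \<Longrightarrow> pdiff \<delta> x = x powr (\<delta> - 1) - inverse x"
  by (simp add: pdiff_def powr_diff diff_divide_distrib inverse_eq_divide)

context
  fixes \<delta> :: real
  assumes \<delta>: "0 < \<delta>" "\<delta> \<le> 1 / 100"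
begin

lemma powr_ge_5:
  assumes "5 \<le> x"
  shows "1 + 8 / 5 * \<delta> \<le> x powr \<delta>"
proof -
  have "\<delta> * (8/5) \<le> \<delta> * ln x"
    using \<delta> ln_5_ge assms by (intro mult_left_mono order_trans[OF ln_5_ge]) auto
  hence "1 + 8 / 5 * \<delta> \<le> exp (\<delta> * ln x)"
    using exp_ge_add_one_self[of "\<delta> * ln x"] by linarith
  thus ?thesis using assms by (simp add: powr_def)
qed

text \<open>The second derivative is \<open>x powr (-3)\<close> times
  \<open>(1 - \<delta>) * (2 - \<delta>) * x powr \<delta> - 2\<close>. The gain
  \<open>8 / 5 * \<delta>\<close> in \<open>x powr \<delta>\<close> outweighs the first-order loss
  \<open>3 / 2 * \<delta>\<close> in \<open>(1 - \<delta>) * (2 - \<delta>) / 2\<close>.\<close>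

lemma pdiff_convex: "convex_on {5..} (pdiff \<delta>)"
proof -
  define f where "f = (\<lambda>x::real. x powr (\<delta> - 1) - x powr (-1))"
  define g where "g = (\<lambda>x::real. (\<delta> - 1) * x powr (\<delta> - 2) + x powr (-2))"
  have D: "((\<lambda>x::real. x powr r) has_real_derivative r * x powr (r - 1)) (at x)" if "x > 0" for x r
    using has_real_derivative_powr[OF that] .
  have "convex_on {5..} f"
  proof (rule f''_ge0_imp_convex)
    fix x :: real assume x: "x \<in> {5..}"
    show "(f has_real_derivative g x) (at x)"
      using DERIV_diff[OF D[of x "\<delta> - 1"] D[of x "-1"]] x by (simp add: f_def g_def)
    show "(g has_real_derivative (\<delta> - 1) * ((\<delta> - 2) * x powr (\<delta> - 3)) + (-2) * x powr (-3)) (at x)"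
      using DERIV_add[OF DERIV_cmult[OF D[of x "\<delta> - 2"], of "\<delta> - 1"] D[of x "-2"]] x
      by (simp add: g_def)
    have "0 \<le> \<delta> * (1/5 - 19/5 * \<delta>) + 8/5 * \<delta> ^ 3" using \<delta> by (intro add_nonneg_nonneg mult_nonneg_nonneg) auto
    hence "2 \<le> (1 - \<delta>) * (2 - \<delta>) * (1 + 8/5 * \<delta>)"
      by (simp add: field_simps power3_eq_cube)
    also have "\<dots> \<le> (1 - \<delta>) * (2 - \<delta>) * x powr \<delta>"
      using powr_ge_5[of x] x \<delta> by (intro mult_left_mono) auto
    finally have "0 \<le> ((1 - \<delta>) * (2 - \<delta>) * x powr \<delta> - 2) * x powr (-3)" by simp
    also have "\<dots> = (\<delta> - 1) * ((\<delta> - 2) * x powr (\<delta> - 3)) + (-2) * x powr (-3)"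
      using powr_add[of x \<delta> "-3"] by (simp add: algebra_simps)
    finally show "0 \<le> \<dots>" .
  qed auto
  moreover have "pdiff \<delta> x = f x" if "x \<in> {5..}" for x
    using that by (simp add: f_def pdiff_eq powr_minus)
  moreover have "u * x + v * y \<in> {5..}" if "x \<in> {5..}" "y \<in> {5..}" "0 \<le> u" "0 \<le> v" "u + v = 1" for x y u v :: real
    using convexD[OF convex_real_interval(1)[of 5] that] that by simp
  ultimately show ?thesis unfolding convex_on_def by (metis real_scaleR_def)
qed

lemma pdiff_second_difference:
  assumes "5 \<le> n"
  shows "pdiff \<delta> (real (Suc n)) - pdiff \<delta> (real (Suc (Suc n))) \<le> pdiff \<delta> (real n) - pdiff \<delta> (real (Suc n))"
proof -
  have "pdiff \<delta> ((1 - 1/2) *\<^sub>R real n + (1/2) *\<^sub>R real (n + 2)) \<le> (1 - 1/2) * pdiff \<delta> (real n) + (1/2) * pdiff \<delta> (real (n + 2))"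
    by (rule convex_onD[OF pdiff_convex]) (use assms in auto)
  moreover have "(1 - 1/2) *\<^sub>R real n + (1/2) *\<^sub>R real (n + 2) = real (Suc n)" by (simp add: add_divide_distrib)
  ultimately show ?thesis by simp
qed

lemma pdiff_tendsto_0: "(\<lambda>n. pdiff \<delta> (real n)) \<longlonglongrightarrow> 0"
proof (rule Lim_transform_eventually)
  have "(\<lambda>n. real n powr (\<delta> - 1) - inverse (real n)) \<longlonglongrightarrow> 0 - 0"
    using \<delta> by (intro tendsto_diff tendsto_neg_powr filterlim_real_sequentially lim_inverse_n) auto
  thus "(\<lambda>n. real n powr (\<delta> - 1) - inverse (real n)) \<longlonglongrightarrow> 0" by simp
  show "\<forall>\<^sub>F n in sequentially. real n powr (\<delta> - 1) - inverse (real n) = pdiff \<delta> (real n)"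
    using eventually_gt_at_top[of 0] by eventually_elim (simp add: pdiff_eq)
qed

lemma pdiff_antimono:
  assumes "5 \<le> x" "x \<le> y"
  shows "pdiff \<delta> y \<le> pdiff \<delta> x"
proof -
  have "y powr (\<delta> - 1) - inverse y \<le> x powr (\<delta> - 1) - inverse x"
  proof (rule DERIV_nonpos_imp_nonincreasing[OF assms(2)])
    fix t assume t: "x \<le> t" "t \<le> y"
    have "0 \<le> \<delta> * (3/5 - 8/5 * \<delta>)" using \<delta> by (intro mult_nonneg_nonneg) auto
    hence "1 \<le> (1 - \<delta>) * (1 + 8/5 * \<delta>)" by (simp add: field_simps)
    also have "\<dots> \<le> (1 - \<delta>) * t powr \<delta>"
      using powr_ge_5[of t] t assms \<delta> by (intro mult_left_mono) auto
    finally have "(1 - (1 - \<delta>) * t powr \<delta>) * t powr (-2) \<le> 0" by (intro mult_nonpos_nonneg) auto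
    moreover have "(1 - (1 - \<delta>) * t powr \<delta>) * t powr (-2) = (\<delta> - 1) * t powr (\<delta> - 1 - 1) - (- (inverse t ^ Suc (Suc 0)))"
      using powr_add[of t \<delta> "-2"] t assms
      by (simp add: algebra_simps powr_minus powr_numeral power2_eq_square)
    moreover have "((\<lambda>x. x powr (\<delta> - 1) - inverse x) has_real_derivative
        (\<delta> - 1) * t powr (\<delta> - 1 - 1) - (- (inverse t ^ Suc (Suc 0)))) (at t)"
      using t assms by (intro DERIV_diff has_real_derivative_powr DERIV_inverse) auto
    ultimately show "\<exists>d. ((\<lambda>x. x powr (\<delta> - 1) - inverse x) has_real_derivative d) (at t) \<and> d \<le> 0"
      by metis
  qed
  thus ?thesis using assms by (simp add: pdiff_eq)
qed

text \<open>Since \<open>x * pdiff \<delta> x = x powr \<delta> - 1\<close> increases,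
  \<open>pdiff\<close> cannot fall fast. This controls the slope of the linear continuation below
  \<open>m\<close>.\<close>

lemma pdiff_step:
  assumes "1 \<le> m"
  shows "real m * (pdiff \<delta> (real m) - pdiff \<delta> (real (Suc m))) \<le> pdiff \<delta> (real m)"
proof -
  have "real m * pdiff \<delta> (real m) = real m powr \<delta> - 1" using assms by (simp add: pdiff_def)
  also have "\<dots> \<le> real (Suc m) powr \<delta> - 1" using \<delta> by (intro diff_right_mono powr_mono2) auto
  also have "\<dots> = real (Suc m) * pdiff \<delta> (real (Suc m))" by (simp add: pdiff_def)
  finally have "real m * pdiff \<delta> (real m) \<le> real (Suc m) * pdiff \<delta> (real (Suc m))" .
  moreover have "pdiff \<delta> (real (Suc m)) * (real m + 1) \<le> pdiff \<delta> (real (Suc m)) * real m + pdiff \<delta> (real m)" if "pdiff \<delta> (real (Suc m)) \<le> pdiff \<delta> (real m)"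
    using that by (simp add: algebra_simps)
  moreover have "real m * (pdiff \<delta> (real m) - pdiff \<delta> (real (Suc m))) \<le> 0" if "pdiff \<delta> (real m) \<le> pdiff \<delta> (real (Suc m))"
    using that by (intro mult_nonneg_nonpos) auto
  moreover have "0 \<le> pdiff \<delta> (real m)" using assms \<delta> by (intro pdiff_nonneg) auto
  ultimately show ?thesis by (smt (verit) of_nat_Suc distrib_left distrib_right mult.commute right_diff_distrib')
qed

end

text \<open>Mean value comparison with the antiderivative \<open>(ln x)\<^sup>2 / 2\<close>. As
  \<open>ln x / x\<close> decreases only beyond \<open>e\<close>, the induction starts at 4, where
  the terms are bounded by multiples of \<open>ln 2\<close>.\<close>

lemma sum_ln_over_n_le:
  assumes "4 \<le> n"
  shows "(\<Sum>k=1..n. ln (real k) / real k) \<le> (ln (real n))\<^sup>2 / 2 + 1"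
  using assms
proof (induction n rule: dec_induct)
  case base
  have "{1..4} = {1,2,3,4::nat}" by auto
  hence "(\<Sum>k=1..4. ln (real k) / real k) = ln 2 / 2 + ln 3 / 3 + ln 4 / 4" by simp
  also have "ln 3 \<le> ln (4::real)" by simp
  also have "ln 4 = 2 * ln (2::real)" using ln_realpow[of 2 2] by simp
  finally have *: "(\<Sum>k=1..4. ln (real k) / real k) \<le> 5 / 3 * ln 2" by simp
  have "(4 / 3)\<^sup>2 \<le> (ln (4::real))\<^sup>2"
    using ln2_ge_two_thirds \<open>ln 4 = 2 * ln 2\<close> by (intro power_mono) auto
  thus ?case using * ln2_le_25_over_36 by (simp add: power2_eq_square)
next
  case (step n)
  have n: "4 \<le> n" using step by simp
  have "\<exists>z>real n. z < real (Suc n) \<and>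
      (ln (real (Suc n)))\<^sup>2 / 2 - (ln (real n))\<^sup>2 / 2 = (real (Suc n) - real n) * (ln z / z)"
    by (rule MVT2) (use n in \<open>auto intro!: derivative_eq_intros\<close>)
  then obtain z where z: "real n < z" "z < real (Suc n)"
    "(ln (real (Suc n)))\<^sup>2 / 2 - (ln (real n))\<^sup>2 / 2 = ln z / z" by auto
  have "ln (real (Suc n)) / real (Suc n) \<le> ln z / z"
    by (rule ln_x_over_x_mono) (use z n e_less_272 in auto)
  thus ?case using step z(3) by simp
qed

text \<open>The tangent continuation \<open>h\<close> may exceed \<open>f\<close> only where \<open>f\<close> is not convex, i.e. for \<open>k < 5\<close>;
  there \<open>\<bar>f - h\<bar> \<le> f - h + 2 h\<close> and \<open>h \<le> 2 f m\<close>.\<close>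

lemma convex_truncation_bound:
  fixes c :: "nat \<Rightarrow> real"
  assumes c: "c 0 = 0" "\<And>k. \<bar>c k\<bar> \<le> 1"
    and A: "\<And>N. \<bar>sum c {..<N}\<bar> \<le> C"
    and B: "\<And>N. \<bar>\<Sum>n<N. sum c {..<Suc n}\<bar> \<le> w * real N"
    and w: "2 * w \<le> real m" and m: "5 \<le> m" and \<delta>: "0 < \<delta>" "\<delta> \<le> 1 / 100"
  shows "\<bar>\<Sum>k. c k * pdiff \<delta> (real k)\<bar> \<le>
    (\<Sum>k=1..<m. pdiff \<delta> (real k)) + (35 / 2 - real m / 2) * pdiff \<delta> (real m)"
proof -
  define f where "f n = pdiff \<delta> (real n)" for n
  define D where "D = f m - f (Suc m)"
  define h where "h n = (if m \<le> n then f n else f m + (real m - real n) * D)" for n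
  have D0: "D \<ge> 0" unfolding D_def f_def using pdiff_antimono[OF \<delta>, of "real m" "real (Suc m)"] m by simp
  have mD: "real m * D \<le> f m" unfolding D_def f_def using pdiff_step[OF \<delta>, of m] m by simp
  have f0: "f n \<ge> 0" if "n \<ge> 1" for n
    unfolding f_def by (rule pdiff_nonneg) (use \<delta> that in auto)
  have fconv: "f (Suc n) - f (Suc (Suc n)) \<le> f n - f (Suc n)" if "5 \<le> n" for n
    unfolding f_def using pdiff_second_difference[OF \<delta> that] .
  have fdec: "f (Suc n) \<le> f n" if "5 \<le> n" for n
    unfolding f_def by (rule pdiff_antimono[OF \<delta>]) (use that in auto)
  have hdec: "decseq h" unfolding decseq_Suc_iff
  proof
    fix n
    consider "m \<le> n" | "Suc n = m" | "Suc n < m" by linarith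
    thus "h (Suc n) \<le> h n"
      by cases (use fdec[of n] m D0 in \<open>auto simp: h_def algebra_simps\<close>)
  qed
  have hconv: "h (Suc n) - h (Suc (Suc n)) \<le> h n - h (Suc n)" for n
  proof -
    consider "m \<le> n" | "Suc n = m" | "Suc (Suc n) = m" | "Suc (Suc n) < m" by linarith
    thus ?thesis
      by cases (use fconv[of n] m in \<open>auto simp: h_def D_def algebra_simps\<close>)
  qed
  have hlim: "h \<longlonglongrightarrow> 0"
  proof (rule Lim_transform_eventually)
    show "f \<longlonglongrightarrow> 0" unfolding f_def by (rule pdiff_tendsto_0[OF \<delta>])
    show "\<forall>\<^sub>F n in sequentially. f n = h n"
      using eventually_ge_at_top[of m] by eventually_elim (simp add: h_def)
  qed
  have sh: "summable (\<lambda>k. c k * h k)" and bh: "\<bar>\<Sum>k. c k * h k\<bar> \<le> w * h 0"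
    using dirichlet_test(1)[OF A hdec hlim] convex_weighted_sum_le[OF A B hdec hlim hconv] by auto
  \<comment> \<open>\<open>f\<close> and \<open>h\<close> differ only below \<open>m\<close>, and
    \<open>c 0 = 0\<close> removes the index 0.\<close>
  have "(\<lambda>k. c k * (f k - h k)) sums (\<Sum>k\<in>{1..<m}. c k * (f k - h k))"
    by (rule sums_finite) (use c(1) in \<open>auto simp: h_def not_less\<close>, (metis One_nat_def Suc_leI bot_nat_0.not_eq_extremum))
  from sums_add[OF this summable_sums[OF sh]]
  have "(\<Sum>k. c k * f k) = (\<Sum>k\<in>{1..<m}. c k * (f k - h k)) + (\<Sum>k. c k * h k)"
    by (simp add: sums_iff algebra_simps)
  hence "\<bar>\<Sum>k. c k * f k\<bar> \<le> \<bar>\<Sum>k\<in>{1..<m}. c k * (f k - h k)\<bar> + w * h 0"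
    using bh by linarith
  also have "\<bar>\<Sum>k\<in>{1..<m}. c k * (f k - h k)\<bar> \<le> (\<Sum>k\<in>{1..<m}. \<bar>f k - h k\<bar>)"
    by (rule order_trans[OF sum_abs sum_mono]) (use c(2) in \<open>auto simp: abs_mult mult_left_le_one_le\<close>)
  also have "\<dots> \<le> (\<Sum>k\<in>{1..<m}. f k - h k + (if k < 5 then 4 * f m else 0))"
  proof (rule sum_mono)
    fix k assume k: "k \<in> {1..<m}"
    have hk: "0 \<le> h k" "h k \<le> 2 * f m"
    proof -
      have "(real m - real k) * D \<le> real m * D" using D0 by (intro mult_right_mono) auto
      thus "h k \<le> 2 * f m" using k mD by (simp add: h_def)
      show "0 \<le> h k" using decseq_ge[OF hdec hlim] .
    qed
    show "\<bar>f k - h k\<bar> \<le> f k - h k + (if k < 5 then 4 * f m else 0)"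
    proof (cases "k < 5")
      case True
      thus ?thesis using hk f0[of k] k by auto
    next
      case False
      have "h k \<le> f k"
      proof -
        \<comment> \<open>Between 5 and \<open>m\<close> convexity makes every step of
          \<open>f\<close> at least the step \<open>D\<close> at \<open>m\<close>, so
          \<open>f\<close> stays above the linear continuation.\<close>
        have dD: "D \<le> f j - f (Suc j)" if "5 \<le> j" "j \<le> m" for j
          using that(2,1) unfolding D_def
        proof (induction j rule: inc_induct)
          case (step n) thus ?case using fconv[of n] by simp
        qed simp
        have "f m + (real m - real j) * D \<le> f j" if "5 \<le> j" "j \<le> m" for j
          using that(2,1)
        proof (induction j rule: inc_induct)
          case (step n)
          thus ?case using dD[of n] by (simp add: algebra_simps)
        qed simp
        from this[of k] False k show ?thesis by (simp add: h_def)
      qed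
      thus ?thesis using False by simp
    qed
  qed
  also have "\<dots> = (\<Sum>k=1..<m. f k) - (\<Sum>k=1..<m. h k) + (\<Sum>k=1..<m. if k < 5 then 4 * f m else 0)"
    by (simp add: sum.distrib sum_subtractf)
  also have "(\<Sum>k=1..<m. if k < 5 then 4 * f m else 0) = 16 * f m"
  proof -
    have "{1..<m} \<inter> {k. k < 5} = {1,2,3,4}" using m by auto
    thus ?thesis by (simp add: sum.If_cases)
  qed
  also have "(\<Sum>k=1..<m. h k) = (real m - 1) * f m + real m * (real m - 1) / 2 * D"
  proof -
    have "(\<Sum>k=1..<j. f m + (real m - real k) * D) = (real j - 1) * f m + ((real j - 1) * real m - real j * (real j - 1) / 2) * D"
      if "1 \<le> j" for j
      using that by (induction j rule: dec_induct) (auto simp: field_simps)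
    from this[of m] m show ?thesis by (simp add: h_def field_simps)
  qed
  \<comment> \<open>Because \<open>w \<le> m / 2\<close>, the terms quadratic in \<open>m\<close>
    cancel against the sum of \<open>h\<close>. Besides \<open>- m / 2\<close> there remain 1, then
    16 from the four indices below 5, and \<open>1 / 2\<close> from \<open>m * D / 2\<close>:
    together \<open>35 / 2\<close>.\<close>
  also have "w * h 0 \<le> real m / 2 * (f m + real m * D)"
    using mult_right_mono[of w "real m / 2" "f m + real m * D"] w m D0 f0[of m] by (simp add: h_def)
  finally have "\<bar>\<Sum>k. c k * f k\<bar> \<le> (\<Sum>k=1..<m. f k) - ((real m - 1) * f m + real m * (real m - 1) / 2 * D) + 16 * f m
      + real m / 2 * (f m + real m * D)" by simp
  also have "\<dots> = (\<Sum>k=1..<m. f k) + (17 - real m / 2) * f m + real m * D / 2" by (simp add: field_simps)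
  also have "\<dots> \<le> (\<Sum>k=1..<m. f k) + (35 / 2 - real m / 2) * f m" using mD by (simp add: algebra_simps)
  finally show ?thesis unfolding f_def .
qed

section \<open>Numerical estimates\<close>

text \<open>Since \<open>exp 1\<close> is below \<open>272 / 100\<close>, comparing powers reduces a
  logarithm bound to rational arithmetic.\<close>

lemma ln_geI:
  assumes "(272 / 100 :: real) ^ a \<le> x ^ b" "0 < x" "0 < b"
  shows "real a / real b \<le> ln x"
proof -
  have "exp (real a) = exp (1::real) ^ a" by (simp flip: exp_of_nat_mult)
  also have "\<dots> \<le> (272 / 100) ^ a" by (intro power_mono) (use e_less_272 in auto)
  also have "\<dots> \<le> x ^ b" by fact
  finally have "real a \<le> ln (x ^ b)" using assms by (subst ln_ge_iff) auto
  also have "\<dots> = real b * ln x" using assms by (simp add: ln_realpow)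
  finally show ?thesis using assms by (simp add: field_simps)
qed

text \<open>With \<open>a = ln m\<close> close to \<open>l / 2\<close>, the sum is about
  \<open>\<delta> * a\<^sup>2 / 2\<close>, hence \<open>\<delta> * l\<^sup>2 / 8\<close>, and the
  term with \<open>- m / 2\<close> gives about \<open>- \<delta> * a / 2\<close>, hence
  \<open>- \<delta> * l / 4\<close>. The smallness of \<delta> keeps \<open>m powr \<delta>\<close>
  near 1, and \<open>11 / 5\<close> absorbs all errors.\<close>

lemma pdiff_sum_bound:
  fixes X s l :: real
  assumes X: "400000 \<le> X" and s: "s = sqrt X" and l: "l = ln X" and m: "m = nat \<lceil>s\<rceil>"
    and \<delta>: "0 < \<delta>" "\<delta> * (s * l\<^sup>2) \<le> 100"
  shows "(\<Sum>k=1..<m. pdiff \<delta> (real k)) + (35 / 2 - real m / 2) * pdiff \<delta> (real m)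
    \<le> \<delta> * (l\<^sup>2 / 8 - l / 4 + 11 / 5)"
    and "\<delta> \<le> 1 / 100"
proof -
  \<comment> \<open>632 and, below, 12.6 are rational lower bounds for the square root and the
    logarithm of 400000.\<close>
  have s632: "632 \<le> s" unfolding s using X by (intro real_le_rsqrt) auto
  have ms: "s \<le> real m" "real m \<le> s + 1" unfolding m using s632 by linarith+
  have l12: "12.6 \<le> l"
  proof -
    have "real 63 / real 5 \<le> ln (400000::real)" by (rule ln_geI) (simp_all add: power_divide)
    also have "\<dots> \<le> ln X" using X by simp
    finally show ?thesis using l by simp
  qed
  have ls: "l = 2 * ln s" unfolding l s using X by (simp add: ln_sqrt)
  \<comment> \<open>\<open>ln x / x\<close> decreases beyond \<open>e\<close>;
    \<open>625 = 5 ^ 4\<close> lies just below 632 and has the logarithm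
    \<open>4 * ln 5\<close>.\<close>
  have l_le: "l \<le> 27/1000 * s"
  proof -
    have "ln (5::real) \<le> ln 8" by simp
    also have "\<dots> = 3 * ln 2" using ln_realpow[of 2 3] by simp
    finally have 5: "ln (5::real) \<le> 25/12" using ln2_le_25_over_36 by simp
    have "ln s / s \<le> ln 625 / 625" by (rule ln_x_over_x_mono) (use s632 e_less_272 in auto)
    also have "ln (625::real) = 4 * ln 5" using ln_realpow[of 5 4] by simp
    finally have "ln s / s \<le> 27 / 2000" using 5 by simp
    thus ?thesis using s632 ls by (simp add: field_simps)
  qed
  define a where "a = ln (real m)"
  have a_ge: "l / 2 \<le> a" unfolding a_def ls using ms s632 by simp
  have a_le: "a \<le> l / 2 + 1 / s"
  proof -
    have "a \<le> ln (s * (1 + 1 / s))" unfolding a_def using ms s632 by (simp add: distrib_left)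
    also have "\<dots> = ln s + ln (1 + 1 / s)" using s632 by (subst ln_mult) (auto simp: add_nonneg_eq_0_iff)
    also have "ln (1 + 1 / s) \<le> 1 / s" using s632 by (intro ln_add_one_self_le_self) auto
    finally show ?thesis using ls by simp
  qed
  have inv: "1 / s \<le> 1 / 632" using s632 by (simp add: field_simps)
  have a_le': "a \<le> 0.501 * l" using a_le inv l12 by simp
  have a0: "6 \<le> a" using a_ge l12 by simp
  have sl2: "632 * 12.6\<^sup>2 \<le> s * l\<^sup>2" using s632 l12 by (intro mult_mono power_mono) auto
  hence "\<delta> * (632 * 12.6\<^sup>2) \<le> \<delta> * (s * l\<^sup>2)" using \<delta> by (intro mult_left_mono) auto
  moreover have "\<delta> * 100000 \<le> \<delta> * (632 * 12.6\<^sup>2)" using \<delta> by (intro mult_left_mono) (auto simp: power2_eq_square)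
  ultimately have "\<delta> * 100000 \<le> 100" using \<delta> by linarith
  thus d100: "\<delta> \<le> 1 / 100" by simp
  define u where "u = \<delta> * a"
  have usl: "u * (s * l) \<le> 50.1"
  proof -
    have "u * (s * l) \<le> (\<delta> * (0.501 * l)) * (s * l)" unfolding u_def
      using a_le' \<delta> s632 l12 by (intro mult_right_mono mult_left_mono) auto
    also have "\<dots> = 0.501 * (\<delta> * (s * l\<^sup>2))" by (simp add: power2_eq_square)
    finally show ?thesis using \<delta> by simp
  qed
  have u0: "0 \<le> u" unfolding u_def using \<delta> a0 by simp
  have usmall: "u \<le> 0.01"
  proof -
    have "u * (632 * 12.6) \<le> u * (s * l)" using s632 l12 u0 by (intro mult_left_mono mult_mono) auto
    thus ?thesis using usl by simp
  qed
  have m0: "m \<noteq> 0" using ms s632 by auto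
  define p where "p = real m powr \<delta>"
  have p: "p \<le> 1 + 1.01 * u"
  proof -
    have "p = exp u" unfolding p_def u_def a_def using m0 by (simp add: powr_def)
    also have "\<dots> \<le> 1 + u + u\<^sup>2" by (rule exp_bound) (use u0 usmall in auto)
    also have "u\<^sup>2 \<le> 0.01 * u" unfolding power2_eq_square using u0 usmall by (intro mult_right_mono) auto
    finally show ?thesis by simp
  qed
  have p1: "p \<le> 1.02" using p usmall by simp
  have p0: "0 \<le> p" by (simp add: p_def)
  have m632: "632 \<le> real m" using ms s632 by simp
  have S: "(\<Sum>k=1..<m. pdiff \<delta> (real k)) \<le> \<delta> * p * (a\<^sup>2 / 2 + 1)"
  proof -
    have "(\<Sum>k=1..<m. pdiff \<delta> (real k)) \<le> (\<Sum>k=1..<m. \<delta> * p * (ln (real k) / real k))"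
    proof (rule sum_mono)
      fix k assume k: "k \<in> {1..<m}"
      have "pdiff \<delta> (real k) \<le> \<delta> * real k powr \<delta> * ln (real k) / real k"
        by (rule pdiff_le) (use \<delta> k in auto)
      also have "\<dots> \<le> \<delta> * p * ln (real k) / real k" unfolding p_def
        using k \<delta> by (intro divide_right_mono mult_right_mono mult_left_mono powr_mono2) auto
      finally show "pdiff \<delta> (real k) \<le> \<delta> * p * (ln (real k) / real k)" by simp
    qed
    also have "\<dots> = \<delta> * p * (\<Sum>k=1..<m. ln (real k) / real k)" by (simp add: sum_distrib_left)
    also have "(\<Sum>k=1..<m. ln (real k) / real k) \<le> (\<Sum>k=1..m. ln (real k) / real k)"
      by (rule sum_mono2) auto
    also have "\<dots> \<le> a\<^sup>2 / 2 + 1" unfolding a_def by (rule sum_ln_over_n_le) (use m632 in auto)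
    finally show ?thesis using \<delta> p0 by (simp add: mult_left_mono)
  qed
  have P1: "pdiff \<delta> (real m) \<le> \<delta> * (p * a / real m)"
    using pdiff_le[of \<delta> "real m"] \<delta> m632 by (simp add: a_def p_def mult.assoc)
  have P2: "\<delta> * (a / 2) \<le> real m / 2 * pdiff \<delta> (real m)"
    using pdiff_ge[of \<delta> "real m"] \<delta> m632 by (simp add: a_def field_simps)
  have "(\<Sum>k=1..<m. pdiff \<delta> (real k)) + (35 / 2 - real m / 2) * pdiff \<delta> (real m)
     = (\<Sum>k=1..<m. pdiff \<delta> (real k)) + 35 / 2 * pdiff \<delta> (real m) - real m / 2 * pdiff \<delta> (real m)"
    by (simp add: left_diff_distrib)
  also have "\<dots> \<le> \<delta> * p * (a\<^sup>2 / 2 + 1) + 35 / 2 * (\<delta> * (p * a / real m)) - \<delta> * (a / 2)"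
    by (intro diff_mono add_mono S P2 mult_left_mono P1) auto
  also have "\<dots> = \<delta> * (p * (a\<^sup>2 / 2 + 1) + 35 / 2 * (p * a / real m) - a / 2)" by (simp add: algebra_simps)
  also have "\<dots> \<le> \<delta> * (l\<^sup>2 / 8 - l / 4 + 11 / 5)"
  proof (rule mult_left_mono)
    have "a\<^sup>2 \<le> (l / 2 + 1 / s)\<^sup>2" using a_le a0 by (intro power_mono) auto
    also have "\<dots> = l\<^sup>2 / 4 + l / s + (1 / s) * (1 / s)" using s632 by (simp add: power2_eq_square field_simps)
    also have "(1 / s) * (1 / s) \<le> 1 * (1 / 632)" using inv s632 by (intro mult_mono) auto
    also have "l / s \<le> 27 / 1000" using l_le s632 by (simp add: field_simps)
    finally have a2: "a\<^sup>2 \<le> l\<^sup>2 / 4 + 0.03" by simp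
    \<comment> \<open>This is how the excess of \<open>p\<close> over 1 affects the main term.
      Trading one factor \<open>l\<close> for a multiple of \<open>s\<close> brings in the bound on
      \<open>u * (s * l)\<close>.\<close>
    have "u * a\<^sup>2 \<le> u * (0.251 * l\<^sup>2)"
    proof (rule mult_left_mono)
      have "a\<^sup>2 \<le> (0.501 * l)\<^sup>2" using a_le' a0 by (intro power_mono) auto
      also have "\<dots> = 0.251001 * l\<^sup>2" by (simp add: power2_eq_square)
      finally show "a\<^sup>2 \<le> 0.251 * l\<^sup>2" using a2 power_mono[OF l12, of 2] by (simp add: power2_eq_square)
    qed (rule u0)
    also have "\<dots> = 0.251 * u * l * l" by (simp add: power2_eq_square)
    also have "\<dots> \<le> 0.251 * u * l * (27/1000 * s)" using l_le u0 l12 by (intro mult_left_mono) auto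
    also have "\<dots> = 0.251 * (27/1000) * (u * (s * l))" by simp
    finally have ua2: "u * a\<^sup>2 \<le> 0.35" using usl by simp
    have "p * (a\<^sup>2 / 2 + 1) \<le> (1 + 1.01 * u) * (a\<^sup>2 / 2 + 1)" using p by (intro mult_right_mono) auto
    also have "\<dots> = a\<^sup>2 / 2 + 1 + 1.01 * u + 0.505 * (u * a\<^sup>2)" by (simp add: algebra_simps)
    also have "\<dots> \<le> l\<^sup>2 / 8 + 1.3" using a2 ua2 usmall by simp
    finally have T1: "p * (a\<^sup>2 / 2 + 1) \<le> l\<^sup>2 / 8 + 1.3" .
    have "a \<le> 0.014 * real m" using a_le' l_le ms(1) s632 by simp
    hence "a / real m \<le> 0.014" using m632 by (simp add: field_simps)
    hence "p * (a / real m) \<le> 1.02 * 0.014" using p1 p0 a0 m632 by (intro mult_mono) auto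
    moreover define r where "r = p * a / real m"
    ultimately have "r \<le> 1 / 50" by simp
    hence T2: "35 / 2 * (p * a / real m) \<le> 0.5" by (simp flip: r_def)
    show "p * (a\<^sup>2 / 2 + 1) + 35 / 2 * (p * a / real m) - a / 2 \<le> l\<^sup>2 / 8 - l / 4 + 11 / 5"
      using add_mono[OF T1 T2] a_ge by simp
  qed (use \<delta> in auto)
  finally show "(\<Sum>k=1..<m. pdiff \<delta> (real k)) + (35 / 2 - real m / 2) * pdiff \<delta> (real m)
    \<le> \<delta> * (l\<^sup>2 / 8 - l / 4 + 11 / 5)" .
qed

text \<open>The range is cut into four pieces; on each, \<open>v\<close> bounds the logarithm from
  its left end and \<open>195 / 10000 * sqrt x\<close> from its right end. The constant is a little
  below \<open>ln x / sqrt x\<close> at 400000, which is about 0.0204.\<close>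

lemma ln_over_sqrt_ge:
  fixes x :: real
  assumes "5 \<le> x" "x \<le> 400000"
  shows "195 / 10000 * sqrt x \<le> ln (x - 3)"
proof -
  have piece: "195 / 10000 * sqrt x \<le> ln (x - 3)" if "v \<le> ln y" "y \<le> x - 3" "0 < y" "x \<le> (v / (195 / 10000))\<^sup>2" "0 \<le> v" for v y
  proof -
    have "sqrt x \<le> v / (195 / 10000)" using that by (intro real_le_lsqrt) auto
    hence "195 / 10000 * sqrt x \<le> v" by simp
    also have "v \<le> ln y" by fact
    also have "\<dots> \<le> ln (x - 3)" using that by simp
    finally show ?thesis .
  qed
  have n1: "7 \<le> ln (1165::real)" using ln_geI[of 7 1165 1] by (simp add: power_divide)
  have n2: "11.7 \<le> ln (128000::real)" using ln_geI[of 117 128000 10] by (simp add: power_divide)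
  have n3: "12.7 \<le> ln (359000::real)" using ln_geI[of 127 359000 10] by (simp add: power_divide)
  consider "x \<le> 1168" | "1168 \<le> x" "x \<le> 128100" | "128100 \<le> x" "x \<le> 359900" | "359900 \<le> x" by linarith
  thus ?thesis
  proof cases
    case 1 show ?thesis by (rule piece[OF ln2_ge_two_thirds]) (use 1 assms in \<open>auto simp: power2_eq_square\<close>)
  next
    case 2 show ?thesis by (rule piece[OF n1]) (use 2 assms in \<open>auto simp: power2_eq_square\<close>)
  next
    case 3 show ?thesis by (rule piece[OF n2]) (use 3 assms in \<open>auto simp: power2_eq_square\<close>)
  next
    case 4 show ?thesis by (rule piece[OF n3]) (use 4 assms in \<open>auto simp: power2_eq_square\<close>)
  qed
qed

text \<open>The upper bound for \<bar>L(1)\<bar> stays below the lower one. If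
  \<open>d > 400000\<close>, then \<open>s = sqrt d\<close> cancels and the leading terms compare
  \<open>100 / 8 = 12.5\<close> with \<open>l \<ge> 12.6\<close>, which ties the constant 100 to the
  threshold 400000. For smaller \<open>d\<close>, \<open>X\<close> is fixed and
  \<open>ln_over_sqrt_ge\<close> suffices.\<close>

lemma numeric_contradiction:
  fixes d \<delta> :: real
  assumes d: "5 \<le> d" and X: "X = max 400000 d" and s: "s = sqrt X" and l: "l = ln X"
    and \<delta>: "0 < \<delta>" "\<delta> * (s * l\<^sup>2) < 100"
  shows "\<delta> * (l\<^sup>2 / 8 - l / 4 + 11 / 5) * sqrt d < ln (d - 3)"
proof -
  have l12: "12.6 \<le> l"
  proof -
    have "real 63 / real 5 \<le> ln (400000::real)" by (rule ln_geI) (simp_all add: power_divide)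
    also have "\<dots> \<le> ln X" using X by simp
    finally show ?thesis using l by simp
  qed
  have s632: "632 \<le> s" unfolding s using X by (intro real_le_rsqrt) auto
  have sl: "0 < s * l\<^sup>2" using s632 l12 by auto
  define K where "K = l\<^sup>2 / 8 - l / 4 + 11 / 5"
  have K0: "0 < K"
  proof -
    have "12 * l \<le> l * l" using l12 by (intro mult_right_mono) auto
    thus ?thesis unfolding K_def power2_eq_square using l12 by linarith
  qed
  have "\<delta> * K * sqrt d * (s * l\<^sup>2) = (\<delta> * (s * l\<^sup>2)) * (K * sqrt d)" by simp
  also have "\<dots> < 100 * (K * sqrt d)" using \<delta> K0 d by (intro mult_strict_right_mono) auto
  also have "\<dots> \<le> ln (d - 3) * (s * l\<^sup>2)"
  proof (cases "d \<le> 400000")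
    case True
    hence X4: "X = 400000" using X by simp
    have "ln X \<le> ln (2 ^ 19)" using X4 by simp
    also have "\<dots> = 19 * ln 2" by (subst ln_realpow) auto
    finally have l14: "l \<le> 14" using l ln2_le_25_over_36 by simp
    have "100 * K \<le> 195 / 10000 * 632 * l\<^sup>2"
    proof -
      have "100 * (x / 8 - l / 4 + 11 / 5) \<le> 12.324 * x" if "x \<le> 14 * l" for x
        using that l12 by simp
      from this[of "l * l"] show ?thesis
        unfolding K_def power2_eq_square using l12 l14 by (simp add: mult_right_mono)
    qed
    also have "\<dots> \<le> 195 / 10000 * (s * l\<^sup>2)" using s632 by (simp add: mult_right_mono)
    finally have "100 * K * sqrt d \<le> 195 / 10000 * (s * l\<^sup>2) * sqrt d" using d by (intro mult_right_mono) auto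
    also have "\<dots> = (195 / 10000 * sqrt d) * (s * l\<^sup>2)" by simp
    also have "\<dots> \<le> ln (d - 3) * (s * l\<^sup>2)"
      using ln_over_sqrt_ge[OF d True] sl by (intro mult_right_mono) auto
    finally show ?thesis by simp
  next
    case False
    hence Xd: "X = d" using X by simp
    have "ln d - ln (d - 3) \<le> (d - (d - 3)) / (d - 3)"
      by (rule ln_diff_le) (use d False in auto)
    also have "\<dots> \<le> 0.001" using False by (simp add: field_simps)
    finally have ln3: "l - 0.001 \<le> ln (d - 3)" using l Xd by simp
    have "100 * K \<le> (l - 0.001) * l\<^sup>2"
    proof -
      have "(12.501) * l\<^sup>2 \<le> (l - 0.001) * l\<^sup>2" using l12 by (intro mult_right_mono) auto
      moreover have "100 * K \<le> 12.501 * l\<^sup>2"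
      proof -
        have "100 * (x / 8 - l / 4 + 11 / 5) \<le> 12.501 * x" if "0 \<le> x" for x using that l12 by simp
        thus ?thesis unfolding K_def by simp
      qed
      ultimately show ?thesis by simp
    qed
    also have "\<dots> \<le> ln (d - 3) * l\<^sup>2" using ln3 by (intro mult_right_mono) auto
    finally have "100 * K * s \<le> ln (d - 3) * l\<^sup>2 * s" using s632 by (intro mult_right_mono) auto
    thus ?thesis using s Xd by (simp add: mult_ac)
  qed
  finally show ?thesis unfolding K_def by (rule mult_right_less_imp_less) (use sl in simp)
qed

section \<open>Roots of unity\<close>

definition unity_root :: "nat \<Rightarrow> int \<Rightarrow> complex" where
  "unity_root d n = cis (2 * pi * of_int n / of_nat d)"

lemma unity_root_0 [simp]: "unity_root d 0 = 1"
  by (simp add: unity_root_def)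

lemma unity_root_add: "unity_root d (m + n) = unity_root d m * unity_root d n"
  by (simp add: unity_root_def cis_mult distrib_left add_divide_distrib)

lemma norm_unity_root [simp]: "cmod (unity_root d n) = 1"
  by (simp add: unity_root_def)

lemma unity_root_neq_0 [simp]: "unity_root d n \<noteq> 0"
  using norm_unity_root[of d n] by force

lemma unity_root_minus: "unity_root d (- n) = cnj (unity_root d n)"
  by (simp add: unity_root_def cis_cnj)

lemma unity_root_power: "unity_root d n ^ k = unity_root d (int k * n)"
  by (induction k) (simp_all add: unity_root_add distrib_right)

lemma prod_unity_root: "(\<Prod>x\<in>A. unity_root d (f x)) = unity_root d (\<Sum>x\<in>A. f x)"
  by (induction A rule: infinite_finite_induct) (simp_all add: unity_root_add)

lemma unity_root_eq_1_iff:
  assumes "0 < d"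
  shows "unity_root d n = 1 \<longleftrightarrow> int d dvd n"
proof
  assume "unity_root d n = 1"
  hence "cos (2 * pi * of_int n / of_nat d) = 1"
    by (simp add: unity_root_def complex_eq_iff)
  then obtain k :: int where "2 * pi * of_int n / of_nat d = of_int k * 2 * pi"
    by (auto simp: cos_one_2pi_int)
  hence "of_int n = (of_int (k * int d) :: real)" using assms by (simp add: field_simps)
  hence "n = k * int d" by (simp only: of_int_eq_iff)
  thus "int d dvd n" by simp
next
  assume "int d dvd n"
  then obtain k where "n = int d * k" by auto
  thus "unity_root d n = 1"
    using assms cis_multiple_2pi[of "of_int k"] by (simp add: unity_root_def mult.assoc)
qed

lemma unity_root_mod [simp]: "unity_root d (n mod int d) = unity_root d n"
proof (cases "d = 0")
  case False
  have "unity_root d n = unity_root d (n mod int d + int d * (n div int d))" by simp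
  also have "\<dots> = unity_root d (n mod int d)"
    using False by (simp only: unity_root_add) (simp add: unity_root_eq_1_iff)
  finally show ?thesis by simp
qed simp

lemma unity_root_cong: "[m = n] (mod int d) \<Longrightarrow> unity_root d m = unity_root d n"
  by (metis unity_root_mod cong_def)

lemma sum_unity_root:
  assumes "0 < d"
  shows "(\<Sum>a\<in>{0..<int d}. unity_root d (a * n)) = (if int d dvd n then of_nat d else 0)"
proof (cases "int d dvd n")
  case True
  hence "unity_root d (a * n) = 1" for a using assms by (simp add: unity_root_eq_1_iff)
  thus ?thesis using True by simp
next
  case False
  let ?S = "\<Sum>a\<in>{0..<int d}. unity_root d (a * n)"
  have bij: "bij_betw (\<lambda>a. (a + 1) mod int d) {0..<int d} {0..<int d}"
  proof -
    have "inj_on (\<lambda>a. (a + 1) mod int d) {0..<int d}"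
    proof (rule inj_onI)
      fix a b assume ab: "a \<in> {0..<int d}" "b \<in> {0..<int d}" "(a + 1) mod int d = (b + 1) mod int d"
      hence "[a = b] (mod int d)" by (metis cong_def cong_add_rcancel)
      thus "a = b" using ab by (simp add: cong_def)
    qed
    moreover have "(\<lambda>a. (a + 1) mod int d) ` {0..<int d} \<subseteq> {0..<int d}" using assms by auto
    ultimately show ?thesis by (simp add: bij_betw_def endo_inj_surj)
  qed
  have "?S = (\<Sum>a\<in>{0..<int d}. unity_root d (((a + 1) mod int d) * n))"
    by (rule sum.reindex_bij_betw[OF bij, symmetric])
  also have "\<dots> = (\<Sum>a\<in>{0..<int d}. unity_root d (a * n) * unity_root d n)"
  proof (rule sum.cong)
    fix a
    have "unity_root d (((a + 1) mod int d) * n) = unity_root d ((a + 1) * n)"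
      by (rule unity_root_cong) (simp add: cong_def mod_mult_left_eq)
    thus "unity_root d (((a + 1) mod int d) * n) = unity_root d (a * n) * unity_root d n"
      by (simp add: distrib_right unity_root_add)
  qed simp
  also have "\<dots> = ?S * unity_root d n" by (simp add: sum_distrib_right)
  finally have "?S * (unity_root d n - 1) = 0" by (simp add: algebra_simps)
  thus ?thesis using False assms by (simp add: unity_root_eq_1_iff)
qed

text \<open>The product of the \<open>X - \<zeta>^k\<close> and the sum
  \<open>1 + X + ... + X^(n-1)\<close> share the leading coefficient and \<open>n - 1\<close> roots,
  so they coincide; evaluate at 1.\<close>

lemma prod_1_minus_unity_root:
  assumes "0 < n"
  shows "(\<Prod>k\<in>{0<..<n}. 1 - unity_root n (int k)) = of_nat n"
proof -
  define p where "p = (\<Prod>k\<in>{0<..<n}. [:- unity_root n (int k), 1:])"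
  define q where "q = (\<Sum>i<n. Polynomial.monom (1::complex) i)"
  have deg_p: "degree p = n - 1" and lead_p: "lead_coeff p = 1"
    unfolding p_def by (subst degree_prod_sum_eq) (auto simp: lead_coeff_prod)
  have coeff_q: "poly.coeff q i = (if i < n then 1 else 0)" for i
    by (simp add: q_def coeff_sum)
  have deg_q: "degree q \<le> n - 1" by (rule degree_le) (auto simp: coeff_q)
  have "p = q"
  proof (rule poly_eqI_degree_lead_coeff)
    show "degree p \<le> n - 1" "degree q \<le> n - 1" using deg_p deg_q by auto
    show "poly.coeff p (n - 1) = poly.coeff q (n - 1)" using deg_p lead_p assms by (simp add: coeff_q)
    show "n - 1 \<le> card ((\<lambda>k. unity_root n (int k)) ` {0<..<n})"
    proof (subst card_image)
      show "inj_on (\<lambda>k. unity_root n (int k)) {0<..<n}"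
      proof (rule inj_onI)
        fix j k assume jk: "j \<in> {0<..<n}" "k \<in> {0<..<n}" "unity_root n (int j) = unity_root n (int k)"
        have "unity_root n (int j - int k) * unity_root n (int k) = unity_root n (int k)"
          by (simp flip: unity_root_add add: jk(3))
        hence "int n dvd int j - int k" using assms by (simp add: unity_root_eq_1_iff)
        hence "[int j = int k] (mod int n)" by (simp add: cong_iff_dvd_diff)
        thus "j = k" using jk by (simp add: cong_def)
      qed
    qed simp
    fix z assume "z \<in> (\<lambda>k. unity_root n (int k)) ` {0<..<n}"
    then obtain k where k: "0 < k" "k < n" "z = unity_root n (int k)" by auto
    have "z \<noteq> 1" using k assms by (auto simp: unity_root_eq_1_iff dest: zdvd_imp_le)
    moreover have "z ^ n = 1" using k assms by (simp add: unity_root_power unity_root_eq_1_iff)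
    ultimately have "poly q z = 0" using geometric_sum[of z n] by (simp add: q_def poly_sum poly_monom)
    moreover have "poly p z = 0" using k by (auto simp: p_def poly_prod)
    ultimately show "poly p z = poly q z" by simp
  qed
  hence "poly p 1 = poly q 1" by simp
  thus ?thesis by (simp add: p_def q_def poly_prod poly_sum poly_monom)
qed

section \<open>Values of cyclotomic polynomials at 1, obtained by sieving one prime at a
  time\<close>

definition sieved_prod :: "nat \<Rightarrow> nat set \<Rightarrow> real" where
  "sieved_prod n Q = (\<Prod>k\<in>{k\<in>{0<..<n}. \<forall>p\<in>Q. \<not> p dvd k}. cmod (1 - unity_root n (int k)))"

lemma sieved_prod_empty: "0 < n \<Longrightarrow> sieved_prod n {} = real n"
proof -
  assume "0 < n"
  moreover have "sieved_prod n {} = (\<Prod>k\<in>{0<..<n}. cmod (1 - unity_root n (int k)))"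
    unfolding sieved_prod_def by (rule prod.cong) auto
  ultimately show ?thesis
    using arg_cong[OF prod_1_minus_unity_root[of n], of cmod] by (simp only: prod_norm norm_of_nat)
qed

lemma unity_root_scale: "0 < r \<Longrightarrow> unity_root (r * n) (int r * k) = unity_root n k"
  by (simp add: unity_root_def mult.assoc)

lemma sieved_prod_pos: "0 < n \<Longrightarrow> 0 < sieved_prod n Q"
  unfolding sieved_prod_def
  by (intro prod_pos) (auto simp: unity_root_eq_1_iff dest: zdvd_imp_le)

text \<open>The indices divisible by \<open>r\<close> are the \<open>r * k\<close> with
  \<open>0 < k < n\<close>. They give the factors of level \<open>n\<close>, and
  \<open>r \<notin> Q\<close> leaves their divisibility by the primes in \<open>Q\<close>
  unchanged.\<close>

lemma sieved_prod_insert: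
  assumes "0 < n" "prime r" "r \<notin> Q" "\<And>p. p \<in> Q \<Longrightarrow> prime p"
  shows "sieved_prod (r * n) Q = sieved_prod (r * n) (insert r Q) * sieved_prod n Q"
proof -
  have r: "0 < r" using assms by (simp add: prime_gt_0_nat)
  let ?f = "\<lambda>k. cmod (1 - unity_root (r * n) (int k))"
  let ?A = "{k\<in>{0<..<r * n}. \<forall>p\<in>Q. \<not> p dvd k}"
  have "sieved_prod n Q = (\<Prod>k\<in>{k\<in>?A. r dvd k}. ?f k)"
    unfolding sieved_prod_def
  proof (rule prod.reindex_bij_witness[of _ "\<lambda>k. k div r" "\<lambda>k. r * k"])
    fix k assume k: "k \<in> {k\<in>{0<..<n}. \<forall>p\<in>Q. \<not> p dvd k}"
    have "\<not> p dvd r * k" if "p \<in> Q" for p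
      using that assms k by (metis (no_types, lifting) mem_Collect_eq prime_dvd_mult_iff primes_dvd_imp_eq)
    thus "r * k \<in> {k\<in>?A. r dvd k}" using k r by auto
    show "cmod (1 - unity_root (r * n) (int (r * k))) = cmod (1 - unity_root n (int k))"
      using unity_root_scale[OF r, of n "int k"] by simp
  qed (use r in \<open>auto simp: less_mult_imp_div_less mult.commute dvd_div_eq_0_iff elim!: dvdE\<close>)
  moreover have "sieved_prod (r * n) (insert r Q) = (\<Prod>k\<in>{k\<in>?A. \<not> r dvd k}. ?f k)"
    unfolding sieved_prod_def by (rule prod.cong) auto
  moreover have "sieved_prod (r * n) Q = (\<Prod>k\<in>{k\<in>?A. \<not> r dvd k} \<union> {k\<in>?A. r dvd k}. ?f k)"
    unfolding sieved_prod_def by (rule prod.cong) auto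
  moreover have "\<dots> = (\<Prod>k\<in>{k\<in>?A. \<not> r dvd k}. ?f k) * (\<Prod>k\<in>{k\<in>?A. r dvd k}. ?f k)"
    by (rule prod.union_disjoint) auto
  ultimately show ?thesis by simp
qed

lemma sieved_prod_singleton:
  assumes "0 < n" "prime p" "p dvd n"
  shows "sieved_prod n {p} = real p"
proof -
  obtain m where m: "n = p * m" using assms by auto
  hence "0 < m" using assms by auto
  hence "real (p * m) = sieved_prod (p * m) {p} * real m"
    using sieved_prod_insert[of m p "{}"] assms m by (simp add: sieved_prod_empty)
  thus ?thesis using m \<open>0 < m\<close> by simp
qed

text \<open>Removing \<open>r\<close> divides the product of level \<open>n\<close> by that of level
  \<open>m = n / r\<close>. Both have the same value: \<open>p\<close> if \<open>Q = {p}\<close>,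
  and 1 by induction otherwise.\<close>

lemma sieved_prod_eq_1:
  assumes "finite Q" "0 < n" "\<And>p. p \<in> Q \<Longrightarrow> prime p \<and> p dvd n" "2 \<le> card Q"
  shows "sieved_prod n Q = 1"
  using assms
proof (induction Q arbitrary: n rule: finite_induct)
  case (insert r Q)
  obtain m where m: "n = r * m" using insert.prems by auto
  have m0: "0 < m" using insert.prems m by auto
  have dvd: "prime p \<and> p dvd m" if "p \<in> Q" for p
  proof -
    have "prime p" "prime r" "p \<noteq> r" "p dvd r * m" using that insert m by auto
    thus ?thesis by (metis prime_dvd_mult_iff primes_dvd_imp_eq)
  qed
  have eq: "sieved_prod n Q = sieved_prod n (insert r Q) * sieved_prod m Q"
    unfolding m by (rule sieved_prod_insert) (use insert m0 dvd in auto)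
  have "sieved_prod n Q = sieved_prod m Q"
  proof (cases "card Q = 1")
    case True
    then obtain p where p: "Q = {p}" by (auto simp: card_1_singleton_iff)
    thus ?thesis using sieved_prod_singleton[of n p] sieved_prod_singleton[of m p] dvd m m0 insert.prems by simp
  next
    case False
    hence "2 \<le> card Q" using insert by simp
    thus ?thesis using insert.IH[of n] insert.IH[of m] insert.prems m0 dvd by simp
  qed
  thus ?case using eq sieved_prod_pos[OF m0, of Q] by simp
qed simp

lemma coprime_iff_not_prime_dvd:
  assumes "0 < (n::nat)"
  shows "coprime k n \<longleftrightarrow> (\<forall>p\<in>prime_factors n. \<not> p dvd k)"
proof
  assume "coprime k n"
  thus "\<forall>p\<in>prime_factors n. \<not> p dvd k"
    by (metis coprime_common_divisor in_prime_factors_iff not_prime_unit)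
next
  assume *: "\<forall>p\<in>prime_factors n. \<not> p dvd k"
  show "coprime k n"
  proof (rule ccontr)
    assume "\<not> coprime k n"
    hence "gcd k n \<noteq> 1" by (metis coprime_iff_gcd_eq_1)
    then obtain p where "prime p" "p dvd gcd k n" using prime_factor_nat by blast
    thus False using * assms by (auto simp: in_prime_factors_iff)
  qed
qed

lemma prod_coprime_norm:
  assumes "0 < n"
  shows "(\<Prod>a\<in>{a\<in>{0..<int n}. coprime a (int n)}. cmod (1 - unity_root n a)) =
    (if n = 1 then 0 else sieved_prod n (prime_factors n))"
proof (cases "n = 1")
  case False
  have "(\<Prod>a\<in>{a\<in>{0..<int n}. coprime a (int n)}. cmod (1 - unity_root n a)) = sieved_prod n (prime_factors n)"
    unfolding sieved_prod_def
  proof (rule prod.reindex_bij_witness[of _ int nat])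
    fix a assume a: "a \<in> {a\<in>{0..<int n}. coprime a (int n)}"
    hence "a \<noteq> 0" using False by auto
    moreover have "coprime (nat a) n" using a by (metis (no_types, lifting) atLeastLessThan_iff coprime_int_iff int_nat_eq mem_Collect_eq)
    ultimately show "nat a \<in> {k\<in>{0<..<n}. \<forall>p\<in>prime_factors n. \<not> p dvd k}"
      using a coprime_iff_not_prime_dvd[OF assms] by auto
  qed (use assms coprime_iff_not_prime_dvd[OF assms] in auto)
  thus ?thesis using False by simp
next
  case True
  have "{a\<in>{0..<int n}. coprime a (int n)} = {0}" using True by auto
  thus ?thesis using True by simp
qed

section \<open>Real characters and Gauss sums\<close>

lemma bij_betw_mult_mod:
  fixes d u :: int
  assumes "0 < d" "coprime u d"
  shows "bij_betw (\<lambda>a. (u * a) mod d) {0..<d} {0..<d}"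
proof -
  have "inj_on (\<lambda>a. (u * a) mod d) {0..<d}"
  proof (rule inj_onI)
    fix a b assume ab: "a \<in> {0..<d}" "b \<in> {0..<d}" "(u * a) mod d = (u * b) mod d"
    hence "[u * a = u * b] (mod d)" by (simp add: cong_def)
    hence "[a = b] (mod d)" using assms(2) by (simp add: cong_mult_lcancel coprime_commute)
    thus "a = b" using ab by (simp add: cong_def)
  qed
  moreover have "(\<lambda>a. (u * a) mod d) ` {0..<d} \<subseteq> {0..<d}" using assms by auto
  ultimately show ?thesis
    by (simp add: bij_betw_def endo_inj_surj)
qed

text \<open>Primitivity is left to an extension, because the descent through moduli and the
  nonvanishing at 1 concern imprimitive characters too.\<close>

locale even_real_character =
  fixes d :: nat and \<psi> :: "int \<Rightarrow> real"
  assumes d_pos: "0 < d"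
    and periodic: "\<psi> (n + int d) = \<psi> n"
    and mult: "\<psi> (m * n) = \<psi> m * \<psi> n"
    and eq_0_iff: "\<psi> n = 0 \<longleftrightarrow> \<not> coprime n (int d)"
    and even: "\<psi> (-1) = 1"
    and nonprincipal: "\<exists>a. coprime a (int d) \<and> \<psi> a \<noteq> 1"
begin

lemma psi_add_mult: "\<psi> (n + k * int d) = \<psi> n"
proof (induction k rule: int_induct[where k = 0])
  case (step1 i) thus ?case using periodic[of "n + i * int d"] by (simp add: algebra_simps)
next
  case (step2 i) thus ?case using periodic[of "n + (i - 1) * int d"] by (simp add: algebra_simps)
qed simp

lemma psi_mod: "\<psi> (n mod int d) = \<psi> n"
  using psi_add_mult[of "n mod int d" "n div int d"] by (simp add: add.commute)

lemma psi_cong: "[a = b] (mod int d) \<Longrightarrow> \<psi> a = \<psi> b"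
  by (metis psi_mod cong_def)

lemma psi_1 [simp]: "\<psi> 1 = 1"
  using mult[of 1 1] eq_0_iff[of 1] by simp

lemma psi_minus [simp]: "\<psi> (- n) = \<psi> n"
  using mult[of "-1" n] even by simp

lemma psi_power: "\<psi> (a ^ n) = \<psi> a ^ n"
  by (induction n) (simp_all add: mult)

lemma d_gt_1: "1 < d"
proof (rule ccontr)
  assume "\<not> 1 < d"
  hence "d = 1" using d_pos by simp
  hence "\<psi> a = \<psi> 1" for a by (intro psi_cong) (simp add: cong_def)
  thus False using nonprincipal by auto
qed

lemma psi_0 [simp]: "\<psi> 0 = 0"
  using d_gt_1 by (simp add: eq_0_iff)

text \<open>By Euler's theorem the value at a unit is a real root of unity.\<close>

lemma psi_cases: "\<psi> a = 0 \<or> \<psi> a = 1 \<or> \<psi> a = -1"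
proof (cases "coprime a (int d)")
  case True
  define b where "b = nat (a mod int d)"
  have ib: "int b = a mod int d" using d_pos by (simp add: b_def)
  have "coprime (int b) (int d)" using True d_pos by (simp add: ib coprime_iff_gcd_eq_1)
  hence "[b ^ totient d = 1] (mod d)" by (intro euler_theorem) simp
  hence "[int b ^ totient d = 1] (mod int d)" by (metis cong_int_iff of_nat_1 of_nat_power)
  hence "\<psi> a ^ totient d = 1"
    using psi_cong[of "(a mod int d) ^ totient d" 1] psi_power[of "int b"] psi_mod[of a] by (simp add: ib)
  hence "\<bar>\<psi> a\<bar> ^ totient d = 1" by (simp flip: power_abs)
  hence "\<bar>\<psi> a\<bar> = 1" using d_pos power_eq_1_iff[of "\<bar>\<psi> a\<bar>" "totient d"] by (simp add: power_eq_1_iff)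
  thus ?thesis by linarith
qed (simp add: eq_0_iff)

lemma abs_psi_le_1: "\<bar>\<psi> a\<bar> \<le> 1"
  using psi_cases[of a] by auto

lemma psi_square: "coprime a (int d) \<Longrightarrow> \<psi> a * \<psi> a = 1"
  using psi_cases[of a] eq_0_iff[of a] by auto

lemma ex_minus_1: "\<exists>a. \<psi> a = -1"
  using nonprincipal psi_cases eq_0_iff by blast

lemma sum_mult_reindex:
  fixes f :: "int \<Rightarrow> 'a :: comm_monoid_add"
  assumes "coprime u (int d)" "\<And>a. f (a mod int d) = f a"
  shows "(\<Sum>a\<in>{0..<int d}. f (u * a)) = (\<Sum>a\<in>{0..<int d}. f a)"
  using sum.reindex_bij_betw[OF bij_betw_mult_mod[of "int d" u], of f] assms d_pos by simp

lemma sum_psi_period: "(\<Sum>a\<in>{0..<int d}. \<psi> a) = 0"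
proof -
  obtain u where u: "\<psi> u = -1" using ex_minus_1 by auto
  have "coprime u (int d)" using u eq_0_iff[of u] by auto
  hence "(\<Sum>a\<in>{0..<int d}. \<psi> (u * a)) = (\<Sum>a\<in>{0..<int d}. \<psi> a)"
    by (rule sum_mult_reindex) (rule psi_mod)
  thus ?thesis using u by (simp add: mult sum_negf)
qed

lemma sum_psi_add_period: "(\<Sum>k<N + d. \<psi> (int k)) = (\<Sum>k<N. \<psi> (int k))"
proof (induction N)
  case 0
  have "(\<Sum>k<d. \<psi> (int k)) = (\<Sum>a\<in>int ` {..<d}. \<psi> a)" by (subst sum.reindex) auto
  also have "int ` {..<d} = {0..<int d}"
    by (simp add: image_int_atLeastLessThan lessThan_atLeast0)
  finally show ?case using sum_psi_period by simp
next
  case (Suc N)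
  thus ?case using periodic[of "int N"] by simp
qed

lemma abs_sum_psi_le: "\<bar>\<Sum>k<N. \<psi> (int k)\<bar> \<le> real d"
proof (induction N rule: less_induct)
  case (less N)
  show ?case
  proof (cases "N < d")
    case True
    have "\<bar>\<Sum>k<N. \<psi> (int k)\<bar> \<le> (\<Sum>k<N. 1)" by (rule order_trans[OF sum_abs sum_mono]) (rule abs_psi_le_1)
    thus ?thesis using True by simp
  next
    case False
    thus ?thesis using less[of "N - d"] sum_psi_add_period[of "N - d"] d_pos by simp
  qed
qed

end

text \<open>No proper divisor is an induced modulus. This form supplies the unit \<open>u\<close>
  that \<open>gauss_twist\<close> and \<open>not_all_squares\<close> work with.\<close>

locale primitive_even_real_character = even_real_character +
  assumes primitive: "\<And>m. m dvd d \<Longrightarrow> m < d \<Longrightarrow> \<exists>u. coprime u (int d) \<and> [u = 1] (mod int m) \<and> \<psi> u \<noteq> 1"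
begin

definition gauss :: complex where
  "gauss = (\<Sum>a\<in>{0..<int d}. \<psi> a * unity_root d a)"

text \<open>For coprime \<open>n\<close>, substitute \<open>n * a\<close> for \<open>a\<close>.
  Otherwise primitivity for \<open>m = d / gcd n d\<close> gives \<open>u\<close> with
  \<open>u = 1\<close> modulo \<open>m\<close> and \<open>\<psi> u = -1\<close>; then
  \<open>u * n = n\<close> modulo \<open>d\<close>, and substituting \<open>u * a\<close> turns the
  sum into its negative.\<close>

lemma gauss_twist: "(\<Sum>a\<in>{0..<int d}. \<psi> a * unity_root d (a * n)) = \<psi> n * gauss"
proof (cases "coprime n (int d)")
  case True
  have "gauss = (\<Sum>a\<in>{0..<int d}. \<psi> (n * a) * unity_root d (n * a))"
    unfolding gauss_def by (rule sum_mult_reindex[symmetric]) (use True in \<open>auto simp: psi_mod\<close>)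
  also have "\<dots> = \<psi> n * (\<Sum>a\<in>{0..<int d}. \<psi> a * unity_root d (a * n))"
    by (simp add: mult sum_distrib_left mult_ac)
  finally have "\<psi> n * gauss = of_real (\<psi> n * \<psi> n) * (\<Sum>a\<in>{0..<int d}. \<psi> a * unity_root d (a * n))"
    by simp
  thus ?thesis using psi_square[OF True] by simp
next
  case False
  define g where "g = gcd n (int d)"
  have g: "g dvd int d" "g dvd n" "0 \<le> g" by (simp_all add: g_def)
  then obtain m where m: "int d = g * m" by auto
  have "g \<noteq> 1" using False by (simp add: g_def coprime_iff_gcd_eq_1)
  moreover have "g \<noteq> 0" using m d_pos by auto
  ultimately have g2: "g \<ge> 2" using g(3) by linarith
  have "0 < g * m" using m d_pos by linarith
  hence m0: "0 < m" using g2 by (simp add: zero_less_mult_iff)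
  have "m dvd int d" using m by simp
  hence "int (nat m) dvd int d" using m0 by simp
  hence "nat m dvd d" by (simp only: of_nat_dvd_iff)
  moreover have "nat m < d"
  proof -
    have "m < g * m" using g2 m0 by simp
    thus ?thesis using m m0 by linarith
  qed
  ultimately have "\<exists>u. coprime u (int d) \<and> [u = 1] (mod int (nat m)) \<and> \<psi> u \<noteq> 1" by (rule primitive)
  then obtain u where u: "coprime u (int d)" "[u = 1] (mod m)" "\<psi> u \<noteq> 1"
    using m0 by auto
  have "[u * n = n] (mod int d)"
  proof -
    obtain k where k: "n = g * k" using g by auto
    have "m dvd u - 1" using u(2) by (simp add: cong_iff_dvd_diff)
    then obtain t where t: "u - 1 = m * t" by auto
    have "u * n - n = (u - 1) * n" by (simp add: algebra_simps)
    also have "\<dots> = int d * (t * k)" by (simp add: m k t)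
    finally show ?thesis by (simp add: cong_iff_dvd_diff)
  qed
  let ?S = "\<Sum>a\<in>{0..<int d}. \<psi> a * unity_root d (a * n)"
  have "?S = (\<Sum>a\<in>{0..<int d}. \<psi> (u * a) * unity_root d ((u * a) * n))"
  proof (rule sum_mult_reindex[symmetric])
    fix a
    have "unity_root d (a mod int d * n) = unity_root d (a * n)"
      by (rule unity_root_cong) (simp add: cong_def mod_mult_left_eq)
    thus "\<psi> (a mod int d) * unity_root d (a mod int d * n) = \<psi> a * unity_root d (a * n)"
      by (simp add: psi_mod)
  qed (fact u)
  also have "\<dots> = \<psi> u * ?S"
  proof -
    have "unity_root d ((u * a) * n) = unity_root d (a * n)" for a
      by (rule unity_root_cong) (use cong_scalar_left[OF \<open>[u * n = n] (mod int d)\<close>, of a] in \<open>simp add: mult_ac\<close>)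
    thus ?thesis by (simp add: mult sum_distrib_left mult_ac)
  qed
  finally have "?S = of_real (\<psi> u) * ?S" .
  moreover have "\<psi> u = -1" using psi_cases[of u] eq_0_iff[of u] u by auto
  ultimately have "?S = - ?S" by (simp only: of_real_minus of_real_1 mult_minus1)
  hence "?S = 0" by (simp only: eq_neg_iff_add_eq_0 mult_2[symmetric]) simp
  thus ?thesis using False eq_0_iff[of n] by simp
qed

text \<open>Expanding one factor by \<open>gauss_twist\<close>, orthogonality leaves only
  \<open>b = -1\<close> modulo \<open>d\<close>, where an even character is 1.\<close>

lemma gauss_square: "gauss * gauss = of_nat d"
proof -
  have "gauss * gauss = (\<Sum>a\<in>{0..<int d}. (\<psi> a * gauss) * unity_root d a)"
    by (subst gauss_def) (simp add: sum_distrib_left sum_distrib_right mult_ac)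
  also have "\<dots> = (\<Sum>a\<in>{0..<int d}. \<Sum>b\<in>{0..<int d}. \<psi> b * unity_root d (b * a) * unity_root d a)"
    by (simp add: sum_distrib_right flip: gauss_twist)
  also have "\<dots> = (\<Sum>b\<in>{0..<int d}. \<psi> b * (\<Sum>a\<in>{0..<int d}. unity_root d (a * (b + 1))))"
    by (subst sum.swap) (simp add: sum_distrib_left distrib_left unity_root_add mult_ac)
  also have "\<dots> = (\<Sum>b\<in>{0..<int d}. if b = int d - 1 then of_nat d else 0)"
  proof (rule sum.cong)
    fix b assume b: "b \<in> {0..<int d}"
    have "int d dvd b + 1 \<longleftrightarrow> b = int d - 1"
    proof
      assume "int d dvd b + 1"
      thus "b = int d - 1" using b zdvd_imp_le[of "int d" "b + 1"] by auto
    qed simp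
    moreover have "\<psi> (int d - 1) = 1" using periodic[of "-1"] even by simp
    ultimately show "\<psi> b * (\<Sum>a\<in>{0..<int d}. unity_root d (a * (b + 1))) = (if b = int d - 1 then of_nat d else 0)"
      using sum_unity_root[OF d_pos, of "b + 1"] by auto
  qed simp
  also have "\<dots> = of_nat d" using d_pos by simp
  finally show ?thesis .
qed

lemma norm_gauss: "cmod gauss = sqrt d"
proof -
  have "cmod gauss ^ 2 = d" using arg_cong[OF gauss_square, of cmod] by (simp add: norm_mult power2_eq_square)
  thus ?thesis by (metis norm_ge_zero real_sqrt_unique)
qed

section \<open>An averaged Polya-Vinogradov inequality\<close>

lemma count_residue:
  assumes "i < N"
  shows "real (card {j\<in>{..<N}. int d dvd int i - int j}) \<le> real N / real d + 1"
proof -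
  let ?A = "{j\<in>{..<N}. int d dvd int i - int j}"
  have "inj_on (\<lambda>j. j div d) ?A"
  proof (rule inj_onI)
    fix j k assume jk: "j \<in> ?A" "k \<in> ?A" "j div d = k div d"
    hence "int d dvd int i - int k" "int d dvd int i - int j" by blast+
    hence "int d dvd (int i - int k) - (int i - int j)" by (rule dvd_diff)
    hence "[int j = int k] (mod int d)" by (simp add: cong_iff_dvd_diff)
    hence "j mod d = k mod d" by (metis cong_int_iff cong_def)
    thus "j = k" using jk(3) by (metis div_mult_mod_eq)
  qed
  moreover have "(\<lambda>j. j div d) ` ?A \<subseteq> {..N div d}" by (auto intro: div_le_mono)
  ultimately have "card ?A \<le> card {..N div d}" by (intro card_inj_on_le) auto
  hence "real (card ?A) \<le> real (N div d) + 1" by simp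
  also have "real (N div d) \<le> real N / real d" by (rule of_nat_div_le_of_nat)
  finally show ?thesis by simp
qed

text \<open>Both sides are twice the sum of \<open>(N - k) * \<psi> k\<close>: a difference
  \<open>k > 0\<close> occurs \<open>N - k\<close> times with either sign, and \<psi> is even with
  \<open>\<psi> 0 = 0\<close>.\<close>

lemma double_sum_eq: "(\<Sum>i<N. \<Sum>j<N. \<psi> (int i - int j)) = 2 * (\<Sum>n<N. \<Sum>k<Suc n. \<psi> (int k))"
proof (induction N)
  case (Suc N)
  have refl: "\<psi> (int i - int N) = \<psi> (int N - int i)" for i
    using psi_minus[of "int N - int i"] by simp
  have "(\<Sum>j<N. \<psi> (int N - int j)) = (\<Sum>k<Suc N. \<psi> (int k))"
  proof -
    have "(\<Sum>j<N. \<psi> (int N - int j)) = (\<Sum>k<N. \<psi> (int N - int (N - Suc k)))"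
      by (rule sum.nat_diff_reindex[symmetric])
    also have "\<dots> = (\<Sum>k<N. \<psi> (int (Suc k)))" by (intro sum.cong) auto
    also have "\<dots> = (\<Sum>k<Suc N. \<psi> (int k))" by (subst sum.lessThan_Suc_shift) simp
    finally show ?thesis .
  qed
  note row = this
  have "(\<Sum>i<Suc N. \<Sum>j<Suc N. \<psi> (int i - int j)) =
      (\<Sum>i<N. \<Sum>j<N. \<psi> (int i - int j)) + 2 * (\<Sum>j<N. \<psi> (int N - int j))"
    by (simp add: sum.distrib refl)
  also have "\<dots> = 2 * (\<Sum>n<Suc N. \<Sum>k<Suc n. \<psi> (int k))"
    unfolding row Suc by (simp only: sum.lessThan_Suc distrib_left)
  finally show ?case .
qed simp

text \<open>The Gauss sum turns the double sum into the sum of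
  \<open>\<psi> a * \<bar>F a\<bar>\<^sup>2\<close> with geometric sums \<open>F a\<close>. By
  Parseval the squares add up to \<open>d\<close> times the number of congruent pairs, at most
  \<open>N\<^sup>2 + d * N\<close>; dropping \<open>a = 0\<close> removes exactly
  \<open>N\<^sup>2\<close>. No logarithm arises, since squares are summed.\<close>

theorem abs_double_sum_le: "\<bar>\<Sum>n<N. \<Sum>k<Suc n. \<psi> (int k)\<bar> \<le> sqrt d / 2 * real N"
proof -
  define F where "F a = (\<Sum>i<N. unity_root d (a * int i))" for a
  have F: "(\<Sum>i<N. \<Sum>j<N. unity_root d (a * (int i - int j))) = of_real ((cmod (F a))\<^sup>2)" for a
  proof -
    have "unity_root d (a * (int i - int j)) = unity_root d (a * int i) * cnj (unity_root d (a * int j))" for i j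
      by (simp flip: unity_root_minus unity_root_add add: algebra_simps)
    hence "(\<Sum>i<N. \<Sum>j<N. unity_root d (a * (int i - int j))) = F a * cnj (F a)"
      by (simp add: F_def sum_product)
    thus ?thesis by (simp only: complex_norm_square)
  qed
  have eq: "of_real (\<Sum>i<N. \<Sum>j<N. \<psi> (int i - int j)) * gauss = of_real (\<Sum>a\<in>{0..<int d}. \<psi> a * (cmod (F a))\<^sup>2)"
  proof -
    have "of_real (\<Sum>i<N. \<Sum>j<N. \<psi> (int i - int j)) * gauss = (\<Sum>i<N. \<Sum>j<N. \<psi> (int i - int j) * gauss)"
      by (simp add: sum_distrib_right)
    also have "\<dots> = (\<Sum>i<N. \<Sum>j<N. \<Sum>a\<in>{0..<int d}. \<psi> a * unity_root d (a * (int i - int j)))"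
      by (simp flip: gauss_twist)
    also have "\<dots> = (\<Sum>i<N. \<Sum>a\<in>{0..<int d}. \<Sum>j<N. \<psi> a * unity_root d (a * (int i - int j)))"
      by (intro sum.cong sum.swap refl)
    also have "\<dots> = (\<Sum>a\<in>{0..<int d}. \<Sum>i<N. \<Sum>j<N. \<psi> a * unity_root d (a * (int i - int j)))"
      by (rule sum.swap)
    also have "\<dots> = (\<Sum>a\<in>{0..<int d}. \<psi> a * (\<Sum>i<N. \<Sum>j<N. unity_root d (a * (int i - int j))))"
      by (simp add: sum_distrib_left)
    finally show ?thesis unfolding F by simp
  qed
  have all: "(\<Sum>a\<in>{0..<int d}. (cmod (F a))\<^sup>2) = real d * (\<Sum>i<N. real (card {j\<in>{..<N}. int d dvd int i - int j}))"
  proof -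
    have "of_real (\<Sum>a\<in>{0..<int d}. (cmod (F a))\<^sup>2) = (\<Sum>a\<in>{0..<int d}. \<Sum>i<N. \<Sum>j<N. unity_root d (a * (int i - int j)))"
      by (simp add: F)
    also have "\<dots> = (\<Sum>i<N. \<Sum>a\<in>{0..<int d}. \<Sum>j<N. unity_root d (a * (int i - int j)))"
      by (rule sum.swap)
    also have "\<dots> = (\<Sum>i<N. \<Sum>j<N. \<Sum>a\<in>{0..<int d}. unity_root d (a * (int i - int j)))"
      by (intro sum.cong sum.swap refl)
    also have "\<dots> = (\<Sum>i<N. \<Sum>j<N. if int d dvd int i - int j then of_nat d else 0)"
      by (simp only: sum_unity_root[OF d_pos])
    also have "\<dots> = of_real (real d * (\<Sum>i<N. real (card {j\<in>{..<N}. int d dvd int i - int j})))"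
      by (simp add: sum.If_cases sum_distrib_left Int_def conj_commute mult.commute)
    finally show ?thesis by (simp only: of_real_eq_iff)
  qed
  have split: "{0..<int d} = insert 0 {0<..<int d}" using d_pos by auto
  have "\<bar>\<Sum>i<N. \<Sum>j<N. \<psi> (int i - int j)\<bar> * sqrt d = \<bar>\<Sum>a\<in>{0..<int d}. \<psi> a * (cmod (F a))\<^sup>2\<bar>"
    using arg_cong[OF eq, of cmod] unfolding norm_mult norm_of_real norm_gauss .
  also have "(\<Sum>a\<in>{0..<int d}. \<psi> a * (cmod (F a))\<^sup>2) = (\<Sum>a\<in>{0<..<int d}. \<psi> a * (cmod (F a))\<^sup>2)"
    unfolding split by simp
  also have "\<bar>\<dots>\<bar> \<le> (\<Sum>a\<in>{0<..<int d}. (cmod (F a))\<^sup>2)"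
    by (rule order_trans[OF sum_abs sum_mono]) (simp add: abs_mult mult_left_le_one_le abs_psi_le_1)
  also have "\<dots> = (\<Sum>a\<in>{0..<int d}. (cmod (F a))\<^sup>2) - (cmod (F 0))\<^sup>2" unfolding split by simp
  also have "\<dots> = real d * (\<Sum>i<N. real (card {j\<in>{..<N}. int d dvd int i - int j})) - (real N)\<^sup>2"
    unfolding all by (simp add: F_def)
  also have "\<dots> \<le> real d * (\<Sum>i<N. real N / real d + 1) - (real N)\<^sup>2"
    by (intro diff_right_mono mult_left_mono sum_mono count_residue) auto
  also have "\<dots> = real d * real N" using d_pos by (simp add: field_simps power2_eq_square)
  also have "\<dots> = (sqrt d * real N) * sqrt d" by simp
  finally have "\<bar>\<Sum>i<N. \<Sum>j<N. \<psi> (int i - int j)\<bar> \<le> sqrt d * real N"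
    using d_pos by (simp only: mult_le_cancel_right) auto
  thus ?thesis unfolding double_sum_eq by simp
qed

end

section \<open>Products of cyclotomic numbers\<close>

context even_real_character
begin

text \<open>Modulo 2, 3 and 4 the only units are 1 and -1, where an even character is 1.\<close>

lemma d_ge_5: "5 \<le> d"
proof (rule ccontr)
  assume "\<not> 5 \<le> d"
  hence d: "d = 2 \<or> d = 3 \<or> d = 4" using d_gt_1 by linarith
  obtain u where u: "\<psi> u = -1" using ex_minus_1 by auto
  have cop: "coprime (u mod int d) (int d)" using u eq_0_iff[of "u mod int d"] by (simp add: psi_mod)
  have "0 \<le> u mod int d" "u mod int d < int d" using d_pos by auto
  moreover have "u mod int d \<noteq> 0" using cop d by auto
  moreover have "\<not> (d = 4 \<and> u mod int d = 2)" using cop by auto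
  ultimately have "u mod int d = 1 \<or> u mod int d = int d - 1" using d by auto
  moreover have "\<psi> (int d - 1) = 1" using periodic[of "-1"] even by simp
  ultimately have "\<psi> (u mod int d) = 1" by auto
  thus False using u by (simp add: psi_mod)
qed

definition fiber :: "real \<Rightarrow> int set" where
  "fiber c = {a\<in>{0..<int d}. \<psi> a = c}"

lemma finite_fiber [simp]: "finite (fiber c)"
  unfolding fiber_def by (rule finite_subset[of _ "{0..<int d}"]) auto

lemma bij_betw_fiber:
  assumes "\<psi> u \<noteq> 0"
  shows "bij_betw (\<lambda>a. (u * a) mod int d) (fiber c) (fiber (\<psi> u * c))"
  unfolding fiber_def
proof (rule bij_betw_Collect)
  show "bij_betw (\<lambda>a. (u * a) mod int d) {0..<int d} {0..<int d}"
    using assms eq_0_iff[of u] d_pos by (intro bij_betw_mult_mod) auto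
qed (use assms in \<open>simp add: psi_mod mult\<close>)

lemma card_fiber: "card (fiber (-1)) = card (fiber 1)"
proof -
  obtain u where "\<psi> u = -1" using ex_minus_1 by auto
  thus ?thesis using bij_betw_same_card[OF bij_betw_fiber[of u 1]] by simp
qed

lemma one_in_fiber: "1 \<in> fiber 1"
  using d_gt_1 by (simp add: fiber_def)

definition fiber_prod :: "real \<Rightarrow> real" where
  "fiber_prod c = (\<Prod>a\<in>fiber c. cmod (1 - unity_root d a))"

lemma fiber_prod_pos:
  assumes "c \<noteq> 0"
  shows "0 < fiber_prod c"
  unfolding fiber_prod_def
proof (rule prod_pos)
  fix a assume a: "a \<in> fiber c"
  have "a \<noteq> 0" using a assms by (auto simp: fiber_def)
  hence "\<not> int d dvd a" using a by (auto simp: fiber_def dest: zdvd_imp_le)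
  thus "0 < cmod (1 - unity_root d a)" using d_pos by (simp add: unity_root_eq_1_iff)
qed

text \<open>The factors for \<open>a\<close> and \<open>d - a\<close> are complex conjugates, so the product is real and positive.\<close>

lemma prod_fiber:
  assumes "c \<noteq> 0"
  shows "(\<Prod>a\<in>fiber c. 1 - unity_root d a) = of_real (fiber_prod c)"
proof -
  let ?z = "\<lambda>a. 1 - unity_root d a"
  let ?S1 = "{a\<in>fiber c. 2 * a < int d}" and ?S2 = "{a\<in>fiber c. int d < 2 * a}"
  have half: "2 * a \<noteq> int d" if "a \<in> fiber c" for a
  proof
    assume *: "2 * a = int d"
    have "coprime a (int d)" using that assms eq_0_iff[of a] by (auto simp: fiber_def)
    moreover have "a dvd int d" using * by (metis dvd_triv_right)
    ultimately have "is_unit a" by (metis coprime_common_divisor dvd_refl)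
    thus False using * d_ge_5 by auto
  qed
  have refl: "\<psi> (int d - a) = \<psi> a" for a
    using periodic[of "- a"] by (simp add: add.commute)
  have "(\<Prod>a\<in>?S2. ?z a) = (\<Prod>a\<in>?S1. cnj (?z a))"
  proof (rule prod.reindex_bij_witness[of _ "\<lambda>a. int d - a" "\<lambda>a. int d - a"])
    fix a assume "a \<in> ?S2"
    have "unity_root d (int d - a) = unity_root d (- a)" by (rule unity_root_cong) (simp add: cong_iff_dvd_diff)
    thus "cnj (?z (int d - a)) = ?z a" by (simp add: unity_root_minus)
  next
    fix a assume a: "a \<in> ?S1"
    have "a \<noteq> 0" using a assms by (auto simp: fiber_def)
    thus "int d - a \<in> ?S2" using a by (auto simp: fiber_def refl)
  qed (auto simp: fiber_def refl)
  moreover have "fiber c = ?S1 \<union> ?S2" using half by force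
  moreover have "(\<Prod>a\<in>?S1 \<union> ?S2. ?z a) = (\<Prod>a\<in>?S1. ?z a) * (\<Prod>a\<in>?S2. ?z a)"
    by (rule prod.union_disjoint) auto
  ultimately have "(\<Prod>a\<in>fiber c. ?z a) = (\<Prod>a\<in>?S1. ?z a * cnj (?z a))"
    by (simp add: prod.distrib)
  also have "\<dots> = of_real (\<Prod>a\<in>?S1. (cmod (?z a))\<^sup>2)" by (simp only: complex_norm_square of_real_prod)
  finally have eq: "(\<Prod>a\<in>fiber c. ?z a) = of_real (\<Prod>a\<in>?S1. (cmod (?z a))\<^sup>2)" .
  have "fiber_prod c = cmod (\<Prod>a\<in>fiber c. ?z a)" by (simp add: fiber_prod_def prod_norm)
  also have "\<dots> = (\<Prod>a\<in>?S1. (cmod (?z a))\<^sup>2)" unfolding eq norm_of_real by (simp add: prod_nonneg)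
  finally show ?thesis using eq by simp
qed

text \<open>For a unit \<open>g\<close> this is the conjugate of the product over the kernel under
  \<zeta> -> \<zeta>^g; admitting all \<open>g\<close> makes complete sums over residues
  available.\<close>

definition unit_prod :: "int \<Rightarrow> complex" where
  "unit_prod g = (\<Prod>a\<in>fiber 1. 1 - unity_root d (g * a))"

lemma unit_prod_eq:
  assumes "\<psi> g \<noteq> 0"
  shows "unit_prod g = of_real (fiber_prod (\<psi> g))"
proof -
  have "unit_prod g = (\<Prod>a\<in>fiber 1. 1 - unity_root d ((g * a) mod int d))" by (simp add: unit_prod_def)
  also have "\<dots> = (\<Prod>a\<in>fiber (\<psi> g * 1). 1 - unity_root d a)"
    by (rule prod.reindex_bij_betw[OF bij_betw_fiber[OF assms]])
  finally show ?thesis using prod_fiber[OF assms] by simp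
qed

lemma unit_prod_0: "unit_prod 0 = 0"
  unfolding unit_prod_def using one_in_fiber by (intro prod_zero) auto

lemma unit_prod_expand: "unit_prod g = (\<Sum>S\<in>Pow (fiber 1). (-1) ^ card S * unity_root d (g * \<Sum>S))"
  unfolding unit_prod_def
  by (subst prod_diff_conv_sum) (simp_all add: prod_unity_root sum_distrib_left)

text \<open>The coefficient of X^k in the product of \<open>1 - X^a\<close> over the kernel, reduced
  modulo \<open>X^d - 1\<close>.\<close>

definition unit_coeff :: "int \<Rightarrow> int" where
  "unit_coeff k = (\<Sum>S\<in>{S\<in>Pow (fiber 1). \<Sum>S mod int d = k}. (-1) ^ card S)"

lemma sum_unit_coeff:
  fixes f :: "int \<Rightarrow> complex"
  assumes "\<And>k. f (k mod int d) = f k"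
  shows "(\<Sum>S\<in>Pow (fiber 1). (-1) ^ card S * f (\<Sum>S)) = (\<Sum>k\<in>{0..<int d}. of_int (unit_coeff k) * f k)"
proof -
  have "(\<Sum>S\<in>Pow (fiber 1). (-1) ^ card S * f (\<Sum>S)) =
      (\<Sum>k\<in>{0..<int d}. \<Sum>S\<in>{S\<in>Pow (fiber 1). \<Sum>S mod int d = k}. (-1) ^ card S * f (\<Sum>S))"
    by (rule sum.group[symmetric]) (use d_pos in auto)
  also have "\<dots> = (\<Sum>k\<in>{0..<int d}. of_int (unit_coeff k) * f k)"
  proof (rule sum.cong)
    fix k
    have "(\<Sum>S\<in>{S\<in>Pow (fiber 1). \<Sum>S mod int d = k}. (-1) ^ card S * f (\<Sum>S)) =
      (\<Sum>S\<in>{S\<in>Pow (fiber 1). \<Sum>S mod int d = k}. (-1) ^ card S * f k)"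
    proof (rule sum.cong)
      fix S assume "S \<in> {S\<in>Pow (fiber 1). \<Sum>S mod int d = k}"
      thus "(-1) ^ card S * f (\<Sum>S) = (-1) ^ card S * f k" using assms[of "\<Sum>S"] by simp
    qed simp
    thus "(\<Sum>S\<in>{S\<in>Pow (fiber 1). \<Sum>S mod int d = k}. (-1) ^ card S * f (\<Sum>S)) = of_int (unit_coeff k) * f k"
      by (simp add: unit_coeff_def sum_distrib_right)
  qed simp
  finally show ?thesis .
qed

text \<open>Multiplication by \<open>u\<close> permutes the kernel, hence its subsets, keeping their
  sizes and multiplying their sums by \<open>u\<close>.\<close>

lemma unit_coeff_invariant:
  assumes u: "\<psi> u = 1" and k: "k \<in> {0..<int d}"
  shows "unit_coeff ((u * k) mod int d) = unit_coeff k"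
proof -
  define F where "F = (\<lambda>a. (u * a) mod int d)"
  have bij: "bij_betw F (fiber 1) (fiber 1)"
    using bij_betw_fiber[of u 1] u by (simp add: F_def)
  have cop: "coprime u (int d)" using u eq_0_iff[of u] by auto
  have sum_F: "(\<Sum>(F ` S) mod int d = (u * k) mod int d) \<longleftrightarrow> (\<Sum>S mod int d = k)" if S: "S \<in> Pow (fiber 1)" for S
  proof -
    have "inj_on F S" using bij S by (auto simp: bij_betw_def intro: inj_on_subset)
    hence "\<Sum>(F ` S) mod int d = (\<Sum>a\<in>S. (u * a) mod int d) mod int d" by (simp add: sum.reindex F_def)
    also have "\<dots> = (u * \<Sum>S) mod int d" by (simp add: mod_sum_eq sum_distrib_left)
    finally have "(\<Sum>(F ` S) mod int d = (u * k) mod int d) \<longleftrightarrow> [u * \<Sum>S = u * k] (mod int d)" by (simp add: cong_def)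
    also have "\<dots> \<longleftrightarrow> [\<Sum>S = k] (mod int d)" using cop by (simp add: cong_mult_lcancel)
    finally show ?thesis using k by (simp add: cong_def)
  qed
  have "bij_betw ((`) F) {S\<in>Pow (fiber 1). \<Sum>S mod int d = k} {S\<in>Pow (fiber 1). \<Sum>S mod int d = (u * k) mod int d}"
    by (rule bij_betw_Collect[OF bij_betw_Pow[OF bij]]) (use sum_F in auto)
  hence "unit_coeff ((u * k) mod int d) = (\<Sum>S\<in>{S\<in>Pow (fiber 1). \<Sum>S mod int d = k}. (-1) ^ card (F ` S))"
    unfolding unit_coeff_def by (rule sum.reindex_bij_betw[symmetric])
  also have "\<dots> = unit_coeff k"
    unfolding unit_coeff_def
  proof (rule sum.cong)
    fix S assume "S \<in> {S\<in>Pow (fiber 1). \<Sum>S mod int d = k}"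
    hence "inj_on F S" using bij by (auto simp: bij_betw_def intro: inj_on_subset)
    thus "(-1) ^ card (F ` S) = ((-1) ^ card S :: int)" by (simp add: card_image)
  qed simp
  finally show ?thesis .
qed

lemma sum_unit_coeff_fiber:
  assumes w: "\<psi> w \<noteq> 0"
  shows "(\<Sum>k\<in>fiber (\<psi> w). unit_coeff k) = int (card (fiber 1)) * unit_coeff (w mod int d)"
proof -
  have "(\<Sum>k\<in>fiber (\<psi> w). unit_coeff k) = (\<Sum>a\<in>fiber 1. unit_coeff ((w * a) mod int d))"
    using sum.reindex_bij_betw[OF bij_betw_fiber[OF w, of 1], of unit_coeff] by simp
  also have "\<dots> = (\<Sum>a\<in>fiber 1. unit_coeff (w mod int d))"
  proof (rule sum.cong)
    fix a assume "a \<in> fiber 1"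
    hence "unit_coeff ((a * (w mod int d)) mod int d) = unit_coeff (w mod int d)"
      using d_pos by (intro unit_coeff_invariant) (auto simp: fiber_def)
    thus "unit_coeff ((w * a) mod int d) = unit_coeff (w mod int d)"
      by (simp add: mod_mult_right_eq mult.commute)
  qed simp
  finally show ?thesis by simp
qed

lemma fiber_split:
  fixes f :: "int \<Rightarrow> 'a :: comm_monoid_add"
  shows "(\<Sum>a\<in>{a\<in>{0..<int d}. \<psi> a \<noteq> 0}. f a) = (\<Sum>a\<in>fiber 1. f a) + (\<Sum>a\<in>fiber (-1). f a)"
proof -
  have "{a\<in>{0..<int d}. \<psi> a \<noteq> 0} = fiber 1 \<union> fiber (-1)"
    using psi_cases by (auto simp: fiber_def)
  moreover have "fiber 1 \<inter> fiber (-1) = {}" by (auto simp: fiber_def)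
  ultimately show ?thesis by (simp add: sum.union_disjoint)
qed

lemma sum_psi_times:
  fixes f :: "int \<Rightarrow> 'a :: real_algebra_1"
  shows "(\<Sum>a\<in>{0..<int d}. of_real (\<psi> a) * f a) = (\<Sum>a\<in>fiber 1. f a) - (\<Sum>a\<in>fiber (-1). f a)"
proof -
  have "(\<Sum>a\<in>{0..<int d}. of_real (\<psi> a) * f a) = (\<Sum>a\<in>{a\<in>{0..<int d}. \<psi> a \<noteq> 0}. of_real (\<psi> a) * f a)"
    by (rule sum.mono_neutral_right) auto
  also have "\<dots> = (\<Sum>a\<in>fiber 1. of_real (\<psi> a) * f a) + (\<Sum>a\<in>fiber (-1). of_real (\<psi> a) * f a)"
    by (rule fiber_split)
  also have "\<dots> = (\<Sum>a\<in>fiber 1. f a) - (\<Sum>a\<in>fiber (-1). f a)"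
    by (simp add: fiber_def sum_negf)
  finally show ?thesis .
qed

lemma fiber_prod_mult:
  "fiber_prod 1 * fiber_prod (-1) = sieved_prod d (prime_factors d)"
proof -
  have "fiber 1 \<union> fiber (-1) = {a\<in>{0..<int d}. coprime a (int d)}"
  proof (intro equalityI subsetI)
    fix a assume "a \<in> fiber 1 \<union> fiber (-1)"
    thus "a \<in> {a\<in>{0..<int d}. coprime a (int d)}" using eq_0_iff[of a] by (auto simp: fiber_def)
  next
    fix a assume "a \<in> {a\<in>{0..<int d}. coprime a (int d)}"
    thus "a \<in> fiber 1 \<union> fiber (-1)" using eq_0_iff[of a] psi_cases[of a] by (auto simp: fiber_def)
  qed
  moreover have "fiber 1 \<inter> fiber (-1) = {}" by (auto simp: fiber_def)
  ultimately have "fiber_prod 1 * fiber_prod (-1) = (\<Prod>a\<in>{a\<in>{0..<int d}. coprime a (int d)}. cmod (1 - unity_root d a))"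
    unfolding fiber_prod_def by (metis (no_types, lifting) finite_fiber prod.union_disjoint)
  thus ?thesis using prod_coprime_norm[OF d_pos] d_gt_1 by simp
qed

end

context primitive_even_real_character
begin

text \<open>The coefficients of the expanded product, reduced modulo \<open>X^d - 1\<close>, are constant on the cosets
  of the kernel of \<open>\<psi>\<close>, and twisting by \<open>\<psi>\<close> annihilates all exponents that are not units.\<close>

lemma fiber_prod_diff:
  "\<exists>y::int. of_real (fiber_prod 1 - fiber_prod (-1)) = gauss * of_int y"
proof -
  obtain w where w: "\<psi> w = -1" using ex_minus_1 by auto
  let ?h = "of_nat (card (fiber 1)) :: complex"
  \<comment> \<open>Summing over whole cosets creates the kernel size \<open>?h\<close> on the left;
    coset invariance of the coefficients creates it on the right as well. Cancelling it leaves an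
    integer \<open>y\<close>.\<close>
  have "?h * of_real (fiber_prod 1 - fiber_prod (-1)) =
     (\<Sum>g\<in>fiber 1. unit_prod g) - (\<Sum>g\<in>fiber (-1). unit_prod g)"
  proof -
    have "(\<Sum>g\<in>fiber c. unit_prod g) = of_nat (card (fiber c)) * of_real (fiber_prod c)" if "c \<noteq> 0" for c
    proof -
      have "(\<Sum>g\<in>fiber c. unit_prod g) = (\<Sum>g\<in>fiber c. of_real (fiber_prod c))"
        by (rule sum.cong) (use that in \<open>auto simp: fiber_def unit_prod_eq\<close>)
      thus ?thesis by simp
    qed
    thus ?thesis by (simp add: card_fiber right_diff_distrib)
  qed
  also have "\<dots> = (\<Sum>g\<in>{0..<int d}. of_real (\<psi> g) * unit_prod g)" by (rule sum_psi_times[symmetric])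
  also have "\<dots> = (\<Sum>g\<in>{0..<int d}. \<Sum>S\<in>Pow (fiber 1). (-1) ^ card S * (of_real (\<psi> g) * unity_root d (g * \<Sum>S)))"
    by (simp add: unit_prod_expand sum_distrib_left mult_ac)
  also have "\<dots> = (\<Sum>S\<in>Pow (fiber 1). (-1) ^ card S * (\<Sum>g\<in>{0..<int d}. of_real (\<psi> g) * unity_root d (g * \<Sum>S)))"
    by (subst sum.swap) (simp add: sum_distrib_left)
  also have "\<dots> = (\<Sum>S\<in>Pow (fiber 1). (-1) ^ card S * of_real (\<psi> (\<Sum>S))) * gauss"
    by (simp add: gauss_twist sum_distrib_right mult.assoc)
  also have "(\<Sum>S\<in>Pow (fiber 1). (-1) ^ card S * of_real (\<psi> (\<Sum>S))) =
      (\<Sum>k\<in>{0..<int d}. of_int (unit_coeff k) * complex_of_real (\<psi> k))"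
    by (rule sum_unit_coeff) (simp add: psi_mod)
  also have "\<dots> = (\<Sum>k\<in>{0..<int d}. complex_of_real (\<psi> k) * of_int (unit_coeff k))" by (simp add: mult.commute)
  also have "\<dots> = (\<Sum>k\<in>fiber 1. of_int (unit_coeff k)) - (\<Sum>k\<in>fiber (-1). of_int (unit_coeff k))"
    by (rule sum_psi_times)
  also have "\<dots> = of_int ((\<Sum>k\<in>fiber (\<psi> 1). unit_coeff k) - (\<Sum>k\<in>fiber (\<psi> w). unit_coeff k))" using w by simp
  also have "\<dots> = ?h * of_int (unit_coeff (1 mod int d) - unit_coeff (w mod int d))"
    by (subst (1 2) sum_unit_coeff_fiber) (use w in \<open>simp_all add: right_diff_distrib\<close>)
  finally have "?h * of_real (fiber_prod 1 - fiber_prod (-1)) =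
      ?h * (gauss * of_int (unit_coeff (1 mod int d) - unit_coeff (w mod int d)))"
    by (simp only: mult_ac)
  moreover have "?h \<noteq> 0" using one_in_fiber by auto
  ultimately have "of_real (fiber_prod 1 - fiber_prod (-1)) = gauss * of_int (unit_coeff (1 mod int d) - unit_coeff (w mod int d))"
    by (simp only: mult_cancel_left) simp
  thus ?thesis by blast
qed

lemma fiber_prod_diff_square:
  "\<exists>y::int. (fiber_prod 1 - fiber_prod (-1))\<^sup>2 = real d * (of_int y)\<^sup>2"
proof -
  obtain y :: int where y: "of_real (fiber_prod 1 - fiber_prod (-1)) = gauss * of_int y"
    using fiber_prod_diff by blast
  have "complex_of_real ((fiber_prod 1 - fiber_prod (-1))\<^sup>2) = of_real (real d * (of_int y)\<^sup>2)"
    unfolding of_real_power y by (simp add: power_mult_distrib gauss_square power2_eq_square)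
  thus ?thesis unfolding of_real_eq_iff by blast
qed

end

text \<open>For prime \<open>d\<close> the units and 0 exhaust the residues, and
  \<open>unit_prod 0 = 0\<close>, so the sum over units is complete. Orthogonality leaves
  \<open>d\<close> times the coefficient at 0.\<close>

lemma (in even_real_character) fiber_prod_sum_prime:
  assumes "prime d"
  shows "\<exists>x::int. fiber_prod 1 + fiber_prod (-1) = real d * of_int x"
proof -
  obtain w where w: "\<psi> w = -1" using ex_minus_1 by auto
  let ?h = "of_nat (card (fiber 1)) :: complex"
  have units: "{a\<in>{0..<int d}. \<psi> a \<noteq> 0} = {0<..<int d}"
  proof -
    have "coprime a (int d)" if "0 < a" "a < int d" for a
      using assms that by (metis coprime_commute prime_imp_coprime prime_int_nat_transfer prime_nat_int_transfer zdvd_not_zless)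
    thus ?thesis using eq_0_iff by (auto, metis less_le psi_0)
  qed
  have split: "{0..<int d} = insert 0 {0<..<int d}" using d_pos by auto
  have "?h * of_real (fiber_prod 1 + fiber_prod (-1)) =
     (\<Sum>g\<in>fiber 1. unit_prod g) + (\<Sum>g\<in>fiber (-1). unit_prod g)"
  proof -
    have "(\<Sum>g\<in>fiber c. unit_prod g) = of_nat (card (fiber c)) * of_real (fiber_prod c)" if "c \<noteq> 0" for c
    proof -
      have "(\<Sum>g\<in>fiber c. unit_prod g) = (\<Sum>g\<in>fiber c. of_real (fiber_prod c))"
        by (rule sum.cong) (use that in \<open>auto simp: fiber_def unit_prod_eq\<close>)
      thus ?thesis by simp
    qed
    thus ?thesis by (simp add: card_fiber distrib_left)
  qed
  also have "\<dots> = (\<Sum>g\<in>{0..<int d}. unit_prod g)"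
    unfolding fiber_split[symmetric] units unfolding split by (simp add: unit_prod_0)
  also have "\<dots> = (\<Sum>S\<in>Pow (fiber 1). (-1) ^ card S * (\<Sum>g\<in>{0..<int d}. unity_root d (g * \<Sum>S)))"
    unfolding unit_prod_expand by (subst sum.swap) (simp add: sum_distrib_left)
  also have "\<dots> = (\<Sum>S\<in>Pow (fiber 1). (-1) ^ card S * (if int d dvd \<Sum>S then of_nat d else 0))"
    by (simp only: sum_unity_root[OF d_pos])
  also have "\<dots> = (\<Sum>k\<in>{0..<int d}. of_int (unit_coeff k) * (if int d dvd k then of_nat d else 0))"
    by (rule sum_unit_coeff) (simp add: dvd_mod_iff)
  also have "\<dots> = of_int (unit_coeff 0) * of_nat d"
  proof -
    have "(\<Sum>k\<in>{0<..<int d}. of_int (unit_coeff k) * (if int d dvd k then of_nat d else 0 :: complex)) = 0"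
      by (rule sum.neutral) (auto dest: zdvd_imp_le)
    thus ?thesis unfolding split by simp
  qed
  \<comment> \<open>The product vanishes at \<open>X = 1\<close>, so the coefficients sum to 0;
    those at units come in two cosets of size \<open>?h\<close>, hence \<open>?h\<close> divides the
    coefficient at 0.\<close>
  also have "complex_of_int (unit_coeff 0) = - ?h * of_int (unit_coeff (1 mod int d) + unit_coeff (w mod int d))"
  proof -
    have "0 = unit_prod 0" by (rule unit_prod_0[symmetric])
    also have "\<dots> = (\<Sum>k\<in>{0..<int d}. of_int (unit_coeff k) * 1)"
      unfolding unit_prod_expand by (subst sum_unit_coeff[symmetric]) simp_all
    also have "\<dots> = of_int (unit_coeff 0 + (\<Sum>k\<in>{0<..<int d}. unit_coeff k))" unfolding split by simp
    also have "(\<Sum>k\<in>{0<..<int d}. unit_coeff k) = (\<Sum>k\<in>fiber (\<psi> 1). unit_coeff k) + (\<Sum>k\<in>fiber (\<psi> w). unit_coeff k)"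
      unfolding units[symmetric] fiber_split using w by simp
    also have "\<dots> = int (card (fiber 1)) * (unit_coeff (1 mod int d) + unit_coeff (w mod int d))"
      by (subst (1 2) sum_unit_coeff_fiber) (use w in \<open>simp_all add: distrib_left\<close>)
    finally have "complex_of_int (unit_coeff 0 + int (card (fiber 1)) * (unit_coeff (1 mod int d) + unit_coeff (w mod int d))) = 0"
      by (rule sym)
    hence "unit_coeff 0 + int (card (fiber 1)) * (unit_coeff (1 mod int d) + unit_coeff (w mod int d)) = 0"
      by (simp only: of_int_eq_0_iff)
    hence "unit_coeff 0 = - (int (card (fiber 1)) * (unit_coeff (1 mod int d) + unit_coeff (w mod int d)))"
      by linarith
    thus ?thesis by simp
  qed
  finally have "?h * of_real (fiber_prod 1 + fiber_prod (-1)) =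
     ?h * (of_nat d * of_int (- (unit_coeff (1 mod int d) + unit_coeff (w mod int d))))"
    by (simp add: algebra_simps)
  moreover have "?h \<noteq> 0" using one_in_fiber by auto
  ultimately have "complex_of_real (fiber_prod 1 + fiber_prod (-1)) =
      of_real (real d * of_int (- (unit_coeff (1 mod int d) + unit_coeff (w mod int d))))"
    by (simp only: mult_cancel_left) simp
  thus ?thesis unfolding of_real_eq_iff by blast
qed

section \<open>The value at 1\<close>

context even_real_character
begin

lemma summable_decseq:
  fixes f :: "nat \<Rightarrow> real"
  assumes "decseq f" "f \<longlonglongrightarrow> 0"
  shows "summable (\<lambda>k. \<psi> (int k) * f k)" "\<bar>\<Sum>k. \<psi> (int k) * f k\<bar> \<le> real d * f 0"
  using dirichlet_test[OF abs_sum_psi_le assms] by auto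

definition L1 :: real where
  "L1 = (\<Sum>k. \<psi> (int k) / real k)"

lemma summable_L1: "summable (\<lambda>k. \<psi> (int k) / real k)"
proof -
  have "summable (\<lambda>k. \<psi> (int k) * (if k = 0 then 1 else 1 / real k))"
  proof (rule summable_decseq(1))
    show "decseq (\<lambda>k::nat. if k = 0 then 1 else 1 / real k)"
      by (rule decseq_SucI) (auto simp: field_simps)
    show "(\<lambda>k::nat. if k = 0 then 1 else 1 / real k) \<longlonglongrightarrow> 0"
      by (rule Lim_transform_eventually[OF lim_1_over_n])
         (use eventually_gt_at_top[of 0] in \<open>eventually_elim, auto\<close>)
  qed
  moreover have "\<psi> (int k) * (if k = 0 then 1 else 1 / real k) = \<psi> (int k) / real k" for k by simp
  ultimately show ?thesis by simp
qed

text \<open>The weights \<open>(1 - x ^ k) / k\<close> decrease to 0, so the Dirichlet test applies.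
  The value at 0 is set to the one at 1, namely \<open>1 - x\<close>.\<close>

lemma abel_limit_bound:
  assumes x: "0 < x" "x < 1"
  shows "summable (\<lambda>k. \<psi> (int k) * x ^ k / real k)"
    and "\<bar>L1 - (\<Sum>k. \<psi> (int k) * x ^ k / real k)\<bar> \<le> real d * (1 - x)"
proof -
  define f where "f k = (if k = 0 then 1 - x else (1 - x ^ k) / real k)" for k
  have dec: "f (Suc k) \<le> f k" for k
  proof (cases "k = 0")
    case False
    have "real k * x ^ k \<le> (\<Sum>i<k. x ^ i)"
    proof -
      have "(\<Sum>i<k. x ^ k) \<le> (\<Sum>i<k. x ^ i)" by (rule sum_mono) (use x in \<open>auto intro: power_decreasing\<close>)
      thus ?thesis by simp
    qed
    hence "(1 - x) * (real k * x ^ k) \<le> (1 - x) * (\<Sum>i<k. x ^ i)" using x by (intro mult_left_mono) auto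
    also have "(1 - x) * (\<Sum>i<k. x ^ i) = 1 - x ^ k" by (simp add: sum_gp_strict)
    finally show ?thesis using False by (simp add: f_def field_simps)
  qed (simp add: f_def)
  have lim: "f \<longlonglongrightarrow> 0"
  proof (rule Lim_null_comparison)
    show "\<forall>\<^sub>F k in sequentially. norm (f k) \<le> 1 / real k"
      using eventually_gt_at_top[of 0]
    proof eventually_elim
      case (elim k)
      have "x ^ k \<le> 1" "0 \<le> x ^ k" using x by (auto intro: power_le_one)
      thus ?case using elim by (simp add: f_def divide_right_mono)
    qed
  qed (rule lim_1_over_n)
  have "decseq f" by (rule decseq_SucI) (rule dec)
  note S = summable_decseq[OF this lim]
  have eq: "\<psi> (int k) * f k = \<psi> (int k) / real k - \<psi> (int k) * x ^ k / real k" for k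
    by (simp add: f_def diff_divide_distrib right_diff_distrib)
  have "summable (\<lambda>k. \<psi> (int k) / real k - \<psi> (int k) * f k)" by (intro summable_diff summable_L1 S(1))
  thus S2: "summable (\<lambda>k. \<psi> (int k) * x ^ k / real k)" by (simp add: eq)
  show "\<bar>L1 - (\<Sum>k. \<psi> (int k) * x ^ k / real k)\<bar> \<le> real d * (1 - x)"
    unfolding L1_def suminf_diff[OF summable_L1 S2] using S(2) by (simp add: eq) (simp add: f_def)
qed

end

text \<open>\<open>gauss_twist\<close> and the logarithmic series are used at
  \<open>x * \<zeta>^a\<close> with \<open>0 < x < 1\<close>, and \<open>x\<close> tends to 1
  through \<open>abel_limit_bound\<close>. Real parts of the logarithms are logarithms of moduli, so
  branches do not matter.\<close>

lemma (in primitive_even_real_character) L1_formula: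
  "sqrt d * \<bar>L1\<bar> = \<bar>ln (fiber_prod 1) - ln (fiber_prod (-1))\<bar>"
proof -
  define F where "F x = (\<Sum>k. \<psi> (int k) * x ^ k / real k)" for x
  define X where "X n = 1 - 1 / real (Suc (Suc n))" for n
  have X: "0 < X n" "X n < 1" for n by (auto simp: X_def field_simps)
  have X_lim: "X \<longlonglongrightarrow> 1"
  proof -
    have "(\<lambda>n. 1 - 1 / real (Suc (Suc n))) \<longlonglongrightarrow> 1 - 0"
      by (intro tendsto_diff tendsto_const LIMSEQ_Suc[OF LIMSEQ_Suc[OF lim_1_over_n]])
    thus ?thesis by (simp add: X_def[abs_def])
  qed
  have lim1: "(\<lambda>n. F (X n)) \<longlonglongrightarrow> L1"
  proof (rule LIM_zero_cancel, rule Lim_null_comparison)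
    show "\<forall>\<^sub>F n in sequentially. norm (F (X n) - L1) \<le> real d * (1 - X n)"
      using abel_limit_bound(2)[OF X] by (auto simp: F_def abs_minus_commute)
    show "(\<lambda>n. real d * (1 - X n)) \<longlonglongrightarrow> 0"
      using tendsto_mult_left[OF tendsto_diff[OF tendsto_const[of 1] X_lim], of "real d"] by simp
  qed
  have G: "gauss * of_real (F x) = - (\<Sum>a\<in>{0..<int d}. of_real (\<psi> a) * ln (1 - of_real x * unity_root d a))"
    if x: "0 < x" "x < 1" for x
  proof -
    have s1: "(\<lambda>k. gauss * of_real (\<psi> (int k) * x ^ k / real k)) sums (gauss * of_real (F x))"
      unfolding F_def by (intro sums_mult sums_of_real summable_sums abel_limit_bound(1) x)
    have s2: "(\<lambda>k. \<Sum>a\<in>{0..<int d}. of_real (\<psi> a) * - ((of_real x * unity_root d a) ^ k / of_nat k)) sums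
      (\<Sum>a\<in>{0..<int d}. of_real (\<psi> a) * ln (1 - of_real x * unity_root d a))"
    proof (intro sums_sum sums_mult)
      fix a
      have "cmod (- (of_real x * unity_root d a)) < 1" using x by (simp add: norm_mult)
      from Ln_series'[OF this]
      show "(\<lambda>k. - ((of_real x * unity_root d a) ^ k / of_nat k)) sums ln (1 - of_real x * unity_root d a)" by simp
    qed
    have "gauss * of_real (\<psi> (int k) * x ^ k / real k) =
      - (\<Sum>a\<in>{0..<int d}. of_real (\<psi> a) * - ((of_real x * unity_root d a) ^ k / of_nat k))" for k
    proof -
      have "gauss * of_real (\<psi> (int k) * x ^ k / real k) = (\<psi> (int k) * gauss) * of_real (x ^ k) / of_nat k"
        by simp
      also have "\<dots> = (\<Sum>a\<in>{0..<int d}. of_real (\<psi> a) * unity_root d (a * int k) * of_real (x ^ k) / of_nat k)"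
        by (simp add: sum_distrib_right sum_divide_distrib flip: gauss_twist)
      also have "\<dots> = (\<Sum>a\<in>{0..<int d}. of_real (\<psi> a) * ((of_real x * unity_root d a) ^ k / of_nat k))"
        by (intro sum.cong) (simp_all add: power_mult_distrib unity_root_power mult_ac)
      finally show ?thesis by (simp add: sum_negf)
    qed
    with s1 sums_minus[OF s2] show ?thesis by (simp only: sums_unique2)
  qed
  define T where "T = (\<lambda>x. \<Sum>a\<in>{0..<int d}. \<psi> a * ln (cmod (1 - of_real x * unity_root d a)))"
  have neq: "1 - of_real x * unity_root d a \<noteq> 0" if "0 < x" "x < 1" for x a
  proof
    assume "1 - of_real x * unity_root d a = 0"
    hence "cmod (of_real x * unity_root d a) = 1" by simp
    thus False using that by (simp add: norm_mult)
  qed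
  \<comment> \<open>Evenness makes the Gauss sum real, so taking real parts keeps its full modulus
    \<open>sqrt d\<close>.\<close>
  have gauss_real: "Im gauss = 0"
  proof -
    have "cnj gauss = (\<Sum>a\<in>{0..<int d}. \<psi> a * unity_root d (a * (-1)))"
      by (simp add: gauss_def unity_root_minus)
    also have "\<dots> = gauss" unfolding gauss_twist using even by simp
    finally show ?thesis by (simp add: complex_eq_iff)
  qed
  have absF: "sqrt d * \<bar>F x\<bar> = \<bar>T x\<bar>" if x: "0 < x" "x < 1" for x
  proof -
    have "Re gauss * F x = Re (gauss * of_real (F x))" by simp
    also have "\<dots> = - T x" unfolding G[OF x] using neq[OF x] by (simp add: T_def Re_sum)
    finally have "\<bar>Re gauss\<bar> * \<bar>F x\<bar> = \<bar>T x\<bar>" by (metis abs_minus_cancel abs_mult)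
    moreover have "\<bar>Re gauss\<bar> = sqrt d" using norm_gauss gauss_real by (simp add: cmod_def)
    ultimately show ?thesis by simp
  qed
  have "(\<lambda>n. T (X n)) \<longlonglongrightarrow> (\<Sum>a\<in>{0..<int d}. \<psi> a * ln (cmod (1 - unity_root d a)))"
    unfolding T_def
  proof (intro tendsto_sum)
    fix a assume a: "a \<in> {0..<int d}"
    show "(\<lambda>n. \<psi> a * ln (cmod (1 - of_real (X n) * unity_root d a))) \<longlonglongrightarrow> \<psi> a * ln (cmod (1 - unity_root d a))"
    \<comment> \<open>At \<open>a = 0\<close> the argument of \<open>ln\<close> tends to 0, but
      \<open>\<psi> 0 = 0\<close> removes the term.\<close>
    proof (cases "a = 0")
      case False
      hence "cmod (1 - unity_root d a) \<noteq> 0" using a d_pos by (auto simp: unity_root_eq_1_iff dest: zdvd_imp_le)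
      moreover have "(\<lambda>n. cmod (1 - of_real (X n) * unity_root d a)) \<longlonglongrightarrow> cmod (1 - of_real 1 * unity_root d a)"
        by (intro tendsto_intros X_lim)
      ultimately show ?thesis by (intro tendsto_mult_left tendsto_ln) simp_all
    qed simp
  qed
  also have "(\<Sum>a\<in>{0..<int d}. \<psi> a * ln (cmod (1 - unity_root d a))) =
      (\<Sum>a\<in>fiber 1. ln (cmod (1 - unity_root d a))) - (\<Sum>a\<in>fiber (-1). ln (cmod (1 - unity_root d a)))"
    using sum_psi_times[of "\<lambda>a. ln (cmod (1 - unity_root d a))"] by simp
  also have "\<dots> = ln (fiber_prod 1) - ln (fiber_prod (-1))"
  proof -
    have "ln (fiber_prod c) = (\<Sum>a\<in>fiber c. ln (cmod (1 - unity_root d a)))" if "c \<noteq> 0" for c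
      unfolding fiber_prod_def
    proof (rule ln_prod)
      fix a assume "a \<in> fiber c"
      thus "cmod (1 - unity_root d a) \<noteq> 0"
        using fiber_prod_pos[OF that] by (auto simp: fiber_prod_def less_le)
    qed simp
    thus ?thesis by simp
  qed
  finally have "(\<lambda>n. \<bar>T (X n)\<bar>) \<longlonglongrightarrow> \<bar>ln (fiber_prod 1) - ln (fiber_prod (-1))\<bar>" by (rule tendsto_rabs)
  moreover have "(\<lambda>n. sqrt d * \<bar>F (X n)\<bar>) \<longlonglongrightarrow> sqrt d * \<bar>L1\<bar>"
    by (intro tendsto_mult_left tendsto_rabs lim1)
  moreover have "(\<lambda>n. sqrt d * \<bar>F (X n)\<bar>) = (\<lambda>n. \<bar>T (X n)\<bar>)" using absF[OF X] by simp
  ultimately show ?thesis by (metis LIMSEQ_unique)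
qed

section \<open>Nonvanishing at 1 through a Lambert series\<close>

lemma split_off_prime_power:
  fixes m :: nat
  assumes "1 < m"
  obtains p k m' where "prime p" "0 < k" "m = p ^ k * m'" "\<not> p dvd m'" "0 < m'" "m' < m"
proof -
  obtain p where p: "prime p" "p dvd m" using assms prime_factor_nat[of m] by auto
  have "m \<noteq> 0" "\<not> is_unit p" using assms p by (auto simp: prime_gt_1_nat)
  then obtain m' where m': "m = p ^ multiplicity p m * m'" "\<not> p dvd m'" by (rule multiplicity_decompose')
  have k: "0 < multiplicity p m" using p assms by (simp add: prime_multiplicity_gt_zero_iff)
  have "0 < m'" using m'(1) assms by (cases m') auto
  moreover have "m' < m"
  proof -
    have "1 < p ^ multiplicity p m" using p(1) k by (intro one_less_power prime_gt_1_nat)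
    hence "1 * m' < p ^ multiplicity p m * m'" using \<open>0 < m'\<close> by (intro mult_strict_right_mono) auto
    thus ?thesis using m'(1) by simp
  qed
  ultimately show ?thesis using that p k m' by blast
qed

text \<open>Pair the terms \<open>i\<close> and \<open>n - 1 - i\<close> and compare arithmetic with
  geometric mean.\<close>

lemma amgm_geometric_sum:
  fixes y :: real
  assumes "0 \<le> y"
  shows "real n * y ^ (n - 1) \<le> (\<Sum>i<n. (y\<^sup>2) ^ i)"
proof -
  have "(\<Sum>i<n. 2 * y ^ (n - 1)) \<le> (\<Sum>i<n. (y\<^sup>2) ^ i + (y\<^sup>2) ^ (n - Suc i))"
  proof (rule sum_mono)
    fix i assume i: "i \<in> {..<n}"
    have "0 \<le> (y ^ i - y ^ (n - Suc i))\<^sup>2" by simp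
    moreover have "y ^ i * y ^ (n - Suc i) = y ^ (n - 1)" using i by (simp flip: power_add)
    ultimately show "2 * y ^ (n - 1) \<le> (y\<^sup>2) ^ i + (y\<^sup>2) ^ (n - Suc i)"
      by (simp add: power2_diff mult.assoc flip: power_mult) (simp add: power_mult[symmetric] mult.commute)
  qed
  also have "\<dots> = 2 * (\<Sum>i<n. (y\<^sup>2) ^ i)"
    using sum.nat_diff_reindex[of "\<lambda>i. (y\<^sup>2) ^ i" n] by (simp add: sum.distrib)
  finally show ?thesis by simp
qed

context even_real_character
begin

text \<open>The Dirichlet convolution of 1 and \<psi>, that is, the coefficients of \<zeta>(s)
  L(s,\<psi>).\<close>

definition divisor_sum :: "nat \<Rightarrow> real" where
  "divisor_sum m = (\<Sum>n | n dvd m. \<psi> (int n))"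

lemma divisor_sum_mult:
  assumes "coprime a b" "0 < a" "0 < b"
  shows "divisor_sum (a * b) = divisor_sum a * divisor_sum b"
proof -
  have "divisor_sum a * divisor_sum b = (\<Sum>(x, y)\<in>{x. x dvd a} \<times> {y. y dvd b}. \<psi> (int (x * y)))"
    by (simp add: divisor_sum_def sum_product sum.cartesian_product mult)
  also have "\<dots> = (\<Sum>n | n dvd a * b. \<psi> (int n))"
  proof -
    have "bij_betw (\<lambda>(x, y). x * y) ({x. x dvd a} \<times> {y. y dvd b}) {n. n dvd a * b}"
      unfolding bij_betw_def
    proof
      show "inj_on (\<lambda>(x, y). x * y) ({x. x dvd a} \<times> {y. y dvd b})"
      proof (rule inj_onI, clarsimp)
        fix x y x' y' assume *: "x dvd a" "y dvd b" "x' dvd a" "y' dvd b" "x * y = x' * y'"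
        have c: "coprime x y'" "coprime x' y" using * assms(1) by (meson coprime_divisors)+
        have "x dvd x'" "x' dvd x" using * c
          by (metis coprime_dvd_mult_left_iff dvd_triv_left)+
        hence "x = x'" by (simp add: dvd_antisym)
        moreover have "x \<noteq> 0" using *(1) assms by auto
        ultimately show "x = x' \<and> y = y'" using * by simp
      qed
      show "(\<lambda>(x, y). x * y) ` ({x. x dvd a} \<times> {y. y dvd b}) = {n. n dvd a * b}"
        by (auto simp: mult_dvd_mono image_iff) (metis division_decomp)
    qed
    from sum.reindex_bij_betw[OF this, of "\<lambda>n. \<psi> (int n)"] show ?thesis
      by (simp add: case_prod_unfold)
  qed
  finally show ?thesis by (simp add: divisor_sum_def)
qed

lemma divisor_sum_prime_power:
  assumes "prime p"
  shows "0 \<le> divisor_sum (p ^ k)" "even k \<Longrightarrow> 1 \<le> divisor_sum (p ^ k)"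
proof -
  have "divisor_sum (p ^ k) = (\<Sum>n\<in>(\<lambda>i. p ^ i) ` {..k}. \<psi> (int n))"
    unfolding divisor_sum_def by (rule sum.cong) (auto simp: divides_primepow_nat[OF assms])
  also have "\<dots> = (\<Sum>i\<le>k. \<psi> (int p) ^ i)"
    using assms by (subst sum.reindex) (auto simp: inj_on_def psi_power power_inject_exp[OF prime_gt_1_nat[OF assms]])
  finally have eq: "divisor_sum (p ^ k) = (\<Sum>i\<le>k. \<psi> (int p) ^ i)" .
  have alt: "(\<Sum>i\<le>k. (-1::real) ^ i) = (if even k then 1 else 0)" by (induction k) auto
  have zero: "(\<Sum>i\<le>k. (0::real) ^ i) = 1" by (induction k) auto
  show "0 \<le> divisor_sum (p ^ k)" "even k \<Longrightarrow> 1 \<le> divisor_sum (p ^ k)"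
    using psi_cases[of "int p"] unfolding eq by (auto simp: alt zero)
qed

lemma divisor_sum_1: "divisor_sum 1 = 1"
  by (simp add: divisor_sum_def)

lemma divisor_sum_nonneg: "0 < m \<Longrightarrow> 0 \<le> divisor_sum m"
proof (induction m rule: less_induct)
  case (less m)
  show ?case
  proof (cases "m = 1")
    case False
    hence "1 < m" using less by simp
    then obtain p k m' where m: "prime p" "0 < k" "m = p ^ k * m'" "\<not> p dvd m'" "0 < m'" "m' < m"
      by (rule split_off_prime_power)
    have "coprime (p ^ k) m'" using m by (simp add: prime_imp_coprime)
    hence "divisor_sum m = divisor_sum (p ^ k) * divisor_sum m'"
      unfolding m(3) using m by (intro divisor_sum_mult) (auto simp: prime_gt_0_nat)
    thus ?thesis using less.IH[of m'] m divisor_sum_prime_power(1)[of p k] by simp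
  qed (simp add: divisor_sum_1[unfolded One_nat_def])
qed

lemma divisor_sum_square: "0 < j \<Longrightarrow> 1 \<le> divisor_sum (j\<^sup>2)"
proof (induction j rule: less_induct)
  case (less j)
  show ?case
  proof (cases "j = 1")
    case False
    hence "1 < j" using less by simp
    then obtain p k m' where m: "prime p" "0 < k" "j = p ^ k * m'" "\<not> p dvd m'" "0 < m'" "m' < j"
      by (rule split_off_prime_power)
    have "coprime (p ^ (2 * k)) (m'\<^sup>2)" using m by (simp add: prime_imp_coprime)
    moreover have j2: "j\<^sup>2 = p ^ (2 * k) * m'\<^sup>2" unfolding m(3) by (simp add: power_mult_distrib power_mult mult.commute)
    ultimately have "divisor_sum (j\<^sup>2) = divisor_sum (p ^ (2 * k)) * divisor_sum (m'\<^sup>2)"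
      unfolding j2 using m by (intro divisor_sum_mult) (auto simp: prime_gt_0_nat)
    moreover have "1 * 1 \<le> divisor_sum (p ^ (2 * k)) * divisor_sum (m'\<^sup>2)"
      using less.IH[of m'] m divisor_sum_prime_power(2)[of p "2 * k"] by (intro mult_mono) auto
    ultimately show ?thesis by simp
  qed (simp add: divisor_sum_1[unfolded One_nat_def])
qed

text \<open>Group the pairs \<open>(n, k)\<close> by \<open>m = n * k\<close>; the cut
  \<open>k \<le> N div n\<close> makes the truncation exact.\<close>

lemma truncated_lambert:
  "(\<Sum>n=1..N. \<psi> (int n) * (\<Sum>k=1..N div n. x ^ (n * k))) = (\<Sum>m=1..N. divisor_sum m * x ^ m)"
proof -
  have aux: "b \<le> N" if "b * k \<le> N" "0 < k" for b k :: nat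
    using that by (metis One_nat_def Suc_leI le_trans mult.right_neutral mult_le_mono2)
  have "(\<Sum>n=1..N. \<psi> (int n) * (\<Sum>k=1..N div n. x ^ (n * k))) =
      (\<Sum>(n, k)\<in>(SIGMA n:{1..N}. {1..N div n}). \<psi> (int n) * x ^ (n * k))"
    by (simp add: sum_distrib_left sum.Sigma)
  also have "\<dots> = (\<Sum>(m, n)\<in>(SIGMA m:{1..N}. {n. n dvd m}). \<psi> (int n) * x ^ m)"
    by (rule sum.reindex_bij_witness[of _ "\<lambda>(m, n). (n, m div n)" "\<lambda>(n, k). (n * k, n)"])
       (auto simp: div_le_mono less_eq_div_iff_mult_less_eq mult.commute Suc_le_eq
          dest: dvd_imp_le aux intro: Nat.gr0I elim!: dvdE)
  also have "\<dots> = (\<Sum>m=1..N. divisor_sum m * x ^ m)"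
    by (subst sum.Sigma[symmetric]) (auto simp: divisor_sum_def sum_distrib_right)
  finally show ?thesis .
qed

text \<open>Keep only the squares among the nonnegative coefficients. Completing each geometric sum
  costs at most \<open>x ^ N / (1 - x)\<close>, as the first missing exponent is at least
  \<open>N\<close>; the total cost vanishes as \<open>N\<close> grows.\<close>

lemma lambert_lower:
  assumes x: "0 < x" "x < 1" and N: "M\<^sup>2 \<le> N"
  shows "(\<Sum>j=1..M. x ^ (j\<^sup>2)) - real N * x ^ N / (1 - x) \<le> (\<Sum>n=1..N. \<psi> (int n) * (x ^ n / (1 - x ^ n)))"
proof -
  have "(\<Sum>j=1..M. x ^ (j\<^sup>2)) \<le> (\<Sum>j=1..M. divisor_sum (j\<^sup>2) * x ^ (j\<^sup>2))"
    by (rule sum_mono) (use divisor_sum_square x in auto)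
  also have "\<dots> = (\<Sum>m\<in>(\<lambda>j. j\<^sup>2) ` {1..M}. divisor_sum m * x ^ m)"
    by (subst sum.reindex) (auto simp: inj_on_def)
  also have "\<dots> \<le> (\<Sum>m=1..N. divisor_sum m * x ^ m)"
  proof (rule sum_mono2)
    show "(\<lambda>j. j\<^sup>2) ` {1..M} \<subseteq> {1..N}"
      using N by (auto intro: order_trans[OF power_mono])
  qed (use divisor_sum_nonneg x in auto)
  also have "\<dots> = (\<Sum>n=1..N. \<psi> (int n) * (\<Sum>k=1..N div n. x ^ (n * k)))"
    by (rule truncated_lambert[symmetric])
  also have "\<dots> \<le> (\<Sum>n=1..N. \<psi> (int n) * (x ^ n / (1 - x ^ n)) + x ^ N / (1 - x))"
  proof (rule sum_mono)
    fix n assume n: "n \<in> {1..N}"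
    define K where "K = N div n"
    have xn: "x ^ n \<le> x" using n x power_decreasing[of 1 n x] by simp
    hence xn1: "x ^ n < 1" using x by simp
    have "(1 - x ^ n) * (\<Sum>k=1..K. x ^ (n * k)) = x ^ n - x ^ (n * Suc K)"
    proof (induction K)
      case (Suc K)
      have "x ^ (n * Suc (Suc K)) = x ^ n * x ^ (n * Suc K)" by (simp add: power_add)
      thus ?case using Suc by (simp add: ring_distribs del: mult_Suc_right)
    qed simp
    hence "(\<Sum>k=1..K. x ^ (n * k)) = x ^ n / (1 - x ^ n) - x ^ (n * Suc K) / (1 - x ^ n)"
      using xn1 by (simp add: diff_divide_distrib[symmetric] eq_divide_eq mult.commute)
    moreover have "x ^ (n * Suc K) / (1 - x ^ n) \<le> x ^ N / (1 - x)"
    proof (rule frac_le)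
      have "N \<le> n * Suc K" unfolding K_def using n
        by (metis (no_types, lifting) atLeastAtMost_iff dividend_less_times_div less_eq_Suc_le less_imp_le mult.commute mult_Suc_right add.commute One_nat_def)
      thus "x ^ (n * Suc K) \<le> x ^ N" using x by (intro power_decreasing) auto
    qed (use x xn in auto)
    moreover have "0 \<le> x ^ (n * Suc K) / (1 - x ^ n)" using x xn1 by simp
    ultimately have "\<bar>(\<Sum>k=1..K. x ^ (n * k)) - x ^ n / (1 - x ^ n)\<bar> \<le> x ^ N / (1 - x)" by linarith
    hence "\<bar>\<psi> (int n)\<bar> * \<bar>(\<Sum>k=1..K. x ^ (n * k)) - x ^ n / (1 - x ^ n)\<bar> \<le> 1 * (x ^ N / (1 - x))"
      by (intro mult_mono abs_psi_le_1) auto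
    hence "\<psi> (int n) * ((\<Sum>k=1..K. x ^ (n * k)) - x ^ n / (1 - x ^ n)) \<le> x ^ N / (1 - x)"
      by (simp flip: abs_mult)
    thus "\<psi> (int n) * (\<Sum>k=1..N div n. x ^ (n * k)) \<le> \<psi> (int n) * (x ^ n / (1 - x ^ n)) + x ^ N / (1 - x)"
      unfolding K_def[symmetric] by (simp add: right_diff_distrib)
  qed
  also have "\<dots> = (\<Sum>n=1..N. \<psi> (int n) * (x ^ n / (1 - x ^ n))) + real N * x ^ N / (1 - x)"
    by (simp add: sum.distrib)
  finally show ?thesis by simp
qed

text \<open>If \<open>L(1) = 0\<close>, the Lambert series stays bounded as \<open>x\<close> tends to \<open>1\<close>, because
  its terms differ from \<open>\<psi> n / (n (1 - x))\<close> by a monotone weight; but its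
  coefficients are nonnegative and at least \<open>1\<close> at squares.\<close>

theorem L1_nonzero: "L1 \<noteq> 0"
proof
  assume L1: "L1 = 0"
  have bound: "(\<Sum>j=1..M. x ^ (j\<^sup>2)) \<le> real d" if x: "0 < x" "x < 1" for x M
  proof -
    \<comment> \<open>\<open>b 0 = b 1 = 1\<close>, so the Dirichlet test gives the bound
      \<open>d\<close> independently of \<open>x\<close>.\<close>
    define b where "b k = (if k = 0 then 1 else 1 / (real k * (1 - x)) - x ^ k / (1 - x ^ k))" for k
    define s where "s n = (\<Sum>i<n. x ^ i)" for n
    have s: "1 - x ^ n = (1 - x) * s n" for n using x by (simp add: s_def sum_gp_strict)
    have spos: "0 < s n" if "0 < n" for n
      unfolding s_def using x that by (intro sum_pos) auto
    have dec: "b (Suc k) \<le> b k" for k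
    proof (cases "k = 0")
      case True thus ?thesis using x by (simp add: b_def field_simps)
    next
      case False
      \<comment> \<open>Monotonicity amounts to
        \<open>k * (k + 1) * x ^ k \<le> s k * s (k + 1)\<close>. The mean inequality bounds the
        right side below by \<open>k * (k + 1) * y ^ (2 * k - 1)\<close>, and
        \<open>y < 1\<close>.\<close>
      define y where "y = sqrt x"
      have y: "0 < y" "y < 1" "y\<^sup>2 = x" using x by (auto simp: y_def)
      have "(real k * real (Suc k)) * x ^ k \<le> (real k * real (Suc k)) * (y ^ (k - 1) * y ^ k)"
      proof (rule mult_left_mono)
        have "y ^ (k + k) \<le> y ^ (k - 1 + k)" using y by (intro power_decreasing) auto
        thus "x ^ k \<le> y ^ (k - 1) * y ^ k"
          by (simp add: power_add flip: y(3) power_mult) (simp add: mult_2 power_add)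
      qed simp
      also have "\<dots> = (real k * y ^ (k - 1)) * (real (Suc k) * y ^ (Suc k - 1))" by simp
      also have "\<dots> \<le> s k * s (Suc k)" unfolding s_def y(3)[symmetric]
        using y by (intro mult_mono amgm_geometric_sum sum_nonneg) auto
      finally have *: "(real k * real (Suc k)) * x ^ k \<le> s k * s (Suc k)" .
      have s1: "s (Suc k) = 1 + x * s k"
        unfolding s_def by (subst sum.lessThan_Suc_shift) (simp add: sum_distrib_left)
      have "x ^ k / s k - x ^ Suc k / s (Suc k) = x ^ k / (s k * s (Suc k))"
        using spos[of k] spos[of "Suc k"] False by (simp add: field_simps s1)
      also have "\<dots> \<le> 1 / (real k * real (Suc k))"
      proof -
        have "u / A \<le> 1 / B" if "B * u \<le> A" "0 < A" "0 < B" for u A B :: real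
          using that by (simp add: field_simps)
        from this[OF *] show ?thesis using spos[of k] spos[of "Suc k"] False by simp
      qed
      also have "\<dots> = 1 / real k - 1 / real (Suc k)" using False by (simp add: field_simps)
      finally have "1 / real (Suc k) - x ^ Suc k / s (Suc k) \<le> 1 / real k - x ^ k / s k" by simp
      hence "(1 / real (Suc k) - x ^ Suc k / s (Suc k)) / (1 - x) \<le> (1 / real k - x ^ k / s k) / (1 - x)"
        using x by (intro divide_right_mono) auto
      thus ?thesis using False by (simp add: b_def s diff_divide_distrib mult.commute del: power_Suc)
    qed
    have lim: "b \<longlonglongrightarrow> 0"
    proof (rule Lim_transform_eventually)
      have p: "(\<lambda>k. x ^ k) \<longlonglongrightarrow> 0" using x by (intro LIMSEQ_realpow_zero) auto
      have "(\<lambda>k. 1 / real k * (1 / (1 - x)) - x ^ k / (1 - x ^ k)) \<longlonglongrightarrow> 0 * (1 / (1 - x)) - 0 / (1 - 0)"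
        by (intro tendsto_intros lim_1_over_n p) auto
      thus "(\<lambda>k. 1 / real k * (1 / (1 - x)) - x ^ k / (1 - x ^ k)) \<longlonglongrightarrow> 0" by simp
      show "\<forall>\<^sub>F k in sequentially. 1 / real k * (1 / (1 - x)) - x ^ k / (1 - x ^ k) = b k"
        using eventually_gt_at_top[of 0] by eventually_elim (simp add: b_def)
    qed
    have "decseq b" by (rule decseq_SucI) (rule dec)
    note S = summable_decseq[OF this lim]
    define g where "g k = \<psi> (int k) / real k * (1 / (1 - x)) - \<psi> (int k) * b k" for k
    have "(\<lambda>k. \<psi> (int k) / real k * (1 / (1 - x)) - \<psi> (int k) * b k) sums (L1 * (1 / (1 - x)) - (\<Sum>k. \<psi> (int k) * b k))"
      unfolding L1_def by (intro sums_diff sums_mult2 summable_sums summable_L1 S(1))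
    hence "g sums - (\<Sum>k. \<psi> (int k) * b k)" by (simp add: g_def[abs_def] L1)
    hence "(\<lambda>N. \<Sum>k<Suc N. g k) \<longlonglongrightarrow> - (\<Sum>k. \<psi> (int k) * b k)"
      unfolding sums_def by (rule LIMSEQ_Suc)
    moreover have "(\<Sum>k<Suc N. g k) = (\<Sum>n=1..N. \<psi> (int n) * (x ^ n / (1 - x ^ n)))" for N
    proof -
      have "(\<Sum>k<Suc N. g k) = (\<Sum>k\<in>insert 0 {1..N}. g k)"
        by (rule sum.cong) auto
      also have "\<dots> = (\<Sum>n=1..N. g n)" by (simp add: g_def)
      also have "\<dots> = (\<Sum>n=1..N. \<psi> (int n) * (x ^ n / (1 - x ^ n)))"
        by (rule sum.cong) (simp_all add: g_def b_def algebra_simps)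
      finally show ?thesis .
    qed
    ultimately have lim1: "(\<lambda>N. \<Sum>n=1..N. \<psi> (int n) * (x ^ n / (1 - x ^ n))) \<longlonglongrightarrow> - (\<Sum>k. \<psi> (int k) * b k)"
      by simp
    have "(\<lambda>N. real N * x ^ N) \<longlonglongrightarrow> 0" using x by (intro powser_times_n_limit_0) auto
    hence "(\<lambda>N. (\<Sum>j=1..M. x ^ (j\<^sup>2)) - real N * x ^ N / (1 - x)) \<longlonglongrightarrow> (\<Sum>j=1..M. x ^ (j\<^sup>2)) - 0 / (1 - x)"
      using x by (intro tendsto_diff tendsto_divide tendsto_const) auto
    from LIMSEQ_le[OF this lim1] have "(\<Sum>j=1..M. x ^ (j\<^sup>2)) - 0 / (1 - x) \<le> - (\<Sum>k. \<psi> (int k) * b k)"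
      using lambert_lower[OF x] by blast
    also have "\<dots> \<le> real d" using S(2) by (simp add: b_def)
    finally show ?thesis by simp
  qed
  \<comment> \<open>With \<open>d + 1\<close> squares the limit \<open>x = 1\<close> gives
    \<open>d + 1 \<le> d\<close>.\<close>
  have "((\<lambda>x::real. \<Sum>j=1..d+1. x ^ (j\<^sup>2)) \<longlongrightarrow> (\<Sum>j=1..d+1. 1 ^ (j\<^sup>2))) (at_left 1)"
    by (intro tendsto_intros)
  moreover have "\<forall>\<^sub>F x::real in at_left 1. (\<Sum>j=1..d+1. x ^ (j\<^sup>2)) \<le> real d"
    by (rule eventually_mono[OF eventually_at_left_real[OF zero_less_one]]) (rule bound, auto)
  ultimately have "(\<Sum>j=1..d+1. (1::real) ^ (j\<^sup>2)) \<le> real d"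
    by (intro tendsto_upperbound[of _ _ "at_left (1::real)"]) auto
  thus False by simp
qed

end

section \<open>Lower bound at 1 from the ratio of the two products\<close>

lemma abs_ln_diff_ge:
  fixes p q D :: real
  assumes "0 < p" "0 < q" "D \<le> p / q + q / p" "3 \<le> D"
  shows "ln (D - 1) \<le> \<bar>ln p - ln q\<bar>"
  using assms
proof (induction p q rule: linorder_wlog)
  case (le p q)
  \<comment> \<open>The smaller quotient is at most 1, so the larger one is at least
    \<open>D - 1\<close>.\<close>
  have "p / q \<le> 1" using le by simp
  hence "D - 1 \<le> q / p" using le by linarith
  hence "ln (D - 1) \<le> ln (q / p)" using le by (subst ln_le_cancel_iff) auto
  also have "\<dots> = ln q - ln p" using le by (simp add: ln_div)
  finally show ?case by simp
qed (simp add: add.commute abs_minus_commute)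

context primitive_even_real_character
begin

text \<open>A real character is 1 on squares of units, so the \<open>u\<close> given by primitivity
  is not a square.\<close>

lemma not_all_squares:
  assumes "m dvd d" "m < d"
  shows "\<exists>t. \<forall>v. \<not> [v * v = 1 + int m * t] (mod int d)"
proof -
  obtain u where u: "coprime u (int d)" "[u = 1] (mod int m)" "\<psi> u \<noteq> 1" using primitive[OF assms] by blast
  have "int m dvd u - 1" using u(2) by (simp add: cong_iff_dvd_diff)
  then obtain t where "u - 1 = int m * t" by auto
  hence t: "u = 1 + int m * t" by simp
  have "\<not> [v * v = u] (mod int d)" for v
  proof
    assume "[v * v = u] (mod int d)"
    hence "\<psi> u = \<psi> v * \<psi> v" by (metis psi_cong mult)
    thus False using u psi_cases[of v] eq_0_iff[of u] by auto
  qed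
  thus ?thesis using t by auto
qed

text \<open>For any other prime power every \<open>1 + m * t\<close> with \<open>m = d / r\<close>
  would be a square modulo \<open>d\<close>, against \<open>not_all_squares\<close>; 4 is excluded
  by \<open>d_ge_5\<close>.\<close>

lemma prime_power_conductor:
  assumes d: "d = r ^ k" and r: "prime r"
  shows "k = 1 \<or> d = 8"
proof (rule ccontr)
  assume *: "\<not> (k = 1 \<or> d = 8)"
  have "k \<noteq> 0" using d d_gt_1 by (intro notI) simp
  hence k: "2 \<le> k" using * by linarith
  have r0: "0 < r" "1 < r" using r prime_gt_0_nat prime_gt_1_nat by auto
  define m where "m = r ^ (k - 1)"
  have dm: "d = r * m" unfolding m_def d using k by (cases k) auto
  have m: "m dvd d" "m < d" using dm r0 d_pos by auto
  have "\<exists>v. [v * v = 1 + int m * t] (mod int d)" for t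
  proof (cases "r = 2")
    case False
    hence "odd r" using r by (metis prime_odd_nat prime_ge_2_nat le_neq_implies_less)
    then obtain s where s: "r = 2 * s + 1" by (auto elim: oddE)
    have "d dvd m * m" unfolding d m_def power_add[symmetric] using k by (intro le_imp_power_dvd) linarith
    then obtain e where e: "m * m = d * e" by auto
    \<comment> \<open>\<open>s + 1\<close> is half of \<open>r + 1\<close>, an inverse of 2 modulo
      \<open>r\<close>; the quadratic term vanishes since \<open>d\<close> divides
      \<open>m * m\<close>.\<close>
    let ?v = "1 + int m * t * (int s + 1)"
    have "?v * ?v - (1 + int m * t) = int (r * m) * t + int (m * m) * (t * t * (int s + 1) * (int s + 1))"
      by (simp add: s algebra_simps)
    also have "\<dots> = int d * (t + int e * (t * t * (int s + 1) * (int s + 1)))"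
      unfolding e dm[symmetric] by (simp add: algebra_simps)
    finally have "[?v * ?v = 1 + int m * t] (mod int d)" by (simp add: cong_iff_dvd_diff)
    thus ?thesis by blast
  next
    case True
    have "k \<noteq> 2" using d_ge_5 d True by auto
    moreover have "k \<noteq> 3" using * d True by auto
    ultimately have k4: "4 \<le> k" using k by linarith
    define n where "n = (2::nat) ^ (k - 2)"
    have mn: "m = 2 * n" unfolding m_def n_def True using k4
      by (metis Suc_diff_Suc Suc_1 Suc_le_lessD k one_add_one plus_1_eq_Suc power_Suc diff_Suc_1 Suc_diff_le)
    have "d dvd n * n" unfolding d n_def power_add[symmetric] True using k4 by (intro le_imp_power_dvd) linarith
    then obtain e where e: "n * n = d * e" by auto
    \<comment> \<open>The cross term is \<open>m * t\<close> exactly, but \<open>d\<close> divides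
      \<open>n * n\<close> only from \<open>k = 4\<close> on; hence the exception 8.\<close>
    let ?v = "1 + int n * t"
    have "?v * ?v - (1 + int m * t) = int (n * n) * (t * t)" by (simp add: mn algebra_simps)
    also have "\<dots> = int d * (int e * (t * t))" unfolding e by simp
    finally have "[?v * ?v = 1 + int m * t] (mod int d)" by (simp add: cong_iff_dvd_diff)
    thus ?thesis by blast
  qed
  thus False using not_all_squares[OF m] by blast
qed

text \<open>The ratio sum is \<open>(p - q)\<^sup>2 / (p * q) + 2\<close> and also
  \<open>(p + q)\<^sup>2 / (p * q) - 2\<close>. The first form serves \<open>p * q = 1\<close> and
  \<open>d = 8\<close>, where \<open>p * q = 2\<close> gives exactly \<open>4 + 2 = d - 2\<close>;
  the second serves primes, where \<open>p + q \<ge> d\<close> and \<open>p * q = d\<close>.\<close>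

lemma fiber_prod_ratio:
  "real d - 2 \<le> fiber_prod 1 / fiber_prod (-1) + fiber_prod (-1) / fiber_prod 1"
proof -
  define p q where "p = fiber_prod 1" and "q = fiber_prod (-1)"
  have pos: "0 < p" "0 < q" using fiber_prod_pos by (auto simp: p_def q_def)
  have pq: "p * q = sieved_prod d (prime_factors d)" unfolding p_def q_def by (rule fiber_prod_mult)
  have ratio: "p / q + q / p = (p - q)\<^sup>2 / (p * q) + 2" "p / q + q / p = (p + q)\<^sup>2 / (p * q) - 2"
    using pos by (simp_all add: field_simps power2_eq_square)
  have diff: "real d \<le> (p - q)\<^sup>2"
  proof -
    obtain y :: int where y: "(p - q)\<^sup>2 = real d * (of_int y)\<^sup>2"
      using fiber_prod_diff_square unfolding p_def q_def by blast
    have "p \<noteq> q" using L1_formula L1_nonzero d_pos unfolding p_def q_def by auto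
    hence "y \<noteq> 0" using y by auto
    hence "1 \<le> y\<^sup>2" by (simp add: int_one_le_iff_zero_less)
    hence "1 \<le> (of_int y :: real)\<^sup>2" by (metis of_int_1_le_iff of_int_power)
    hence "real d * 1 \<le> real d * (of_int y)\<^sup>2" by (intro mult_left_mono) auto
    thus ?thesis using y by simp
  qed
  have dvd: "prime r \<and> r dvd d" if "r \<in> prime_factors d" for r
    using that by (auto simp: in_prime_factors_iff)
  have "real d - 2 \<le> p / q + q / p"
  proof (cases "2 \<le> card (prime_factors d)")
    case True
    hence "p * q = 1" using pq sieved_prod_eq_1[of "prime_factors d" d] dvd d_pos by auto
    thus ?thesis using diff unfolding ratio(1) by simp
  next
    case False
    moreover have "prime_factors d \<noteq> {}"
      using d_gt_1 prime_factor_nat[of d] d_pos by (auto simp: prime_factorization_empty_iff)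
    ultimately have "card (prime_factors d) = 1"
      by (metis One_nat_def Suc_1 card_0_eq finite_set_mset le_less_linear less_2_cases)
    then obtain r where r: "prime_factors d = {r}" by (auto simp: card_1_singleton_iff)
    hence pr: "prime r" "r dvd d" using dvd by auto
    have d: "d = r ^ multiplicity r d" using prime_factorization_nat[of d] d_pos r by simp
    have pqr: "p * q = real r" using pq sieved_prod_singleton[OF d_pos pr] r by simp
    consider "multiplicity r d = 1" | "d = 8" using prime_power_conductor[OF d pr(1)] by blast
    thus ?thesis
    proof cases
      case 1
      hence dr: "d = r" using d by simp
      obtain x :: int where x: "p + q = real d * of_int x"
        using fiber_prod_sum_prime pr(1) dr unfolding p_def q_def by blast
      have "0 < real d * of_int x" using x pos by simp
      hence "0 < x" using d_pos by (simp add: zero_less_mult_iff)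
      hence "real d * 1 \<le> real d * of_int x" by (intro mult_left_mono) auto
      hence "(real d)\<^sup>2 \<le> (p + q)\<^sup>2" using x by (intro power_mono) auto
      hence "real d \<le> (p + q)\<^sup>2 / (p * q)" using pqr dr d_pos by (simp add: field_simps power2_eq_square)
      thus ?thesis unfolding ratio(2) by simp
    next
      case 2
      have "r dvd 2 ^ 3" using pr(2) 2 by simp
      hence "r = 2" using pr(1) by (metis prime_dvd_power primes_dvd_imp_eq two_is_prime_nat)
      hence "4 \<le> (p - q)\<^sup>2 / (p * q)" using diff 2 pqr by simp
      thus ?thesis unfolding ratio(1) using 2 by simp
    qed
  qed
  thus ?thesis by (simp add: p_def q_def)
qed

theorem L1_lower_bound: "ln (real d - 3) \<le> sqrt d * \<bar>L1\<bar>"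
  using abs_ln_diff_ge[OF fiber_prod_pos fiber_prod_pos fiber_prod_ratio] d_ge_5
  by (simp add: L1_formula)

end

section \<open>Reduction to primitive characters\<close>

text \<open>The index 0 contributes 0, since \<open>0 powr a = 0\<close>; so this agrees with the
  shifted series of \<open>dirichlet_L\<close>.\<close>

definition real_L :: "real \<Rightarrow> (int \<Rightarrow> real) \<Rightarrow> real" where
  "real_L s \<psi> = (\<Sum>k. \<psi> (int k) * real k powr (- s))"

context even_real_character
begin

lemma summable_real_L:
  assumes "0 < s"
  shows "summable (\<lambda>k. \<psi> (int k) * real k powr (- s))"
proof -
  have "summable (\<lambda>k. \<psi> (int k) * (if k = 0 then 1 else real k powr (- s)))"
  proof (rule dirichlet_test(1)[OF abs_sum_psi_le])
    show "decseq (\<lambda>k::nat. if k = 0 then 1 else real k powr (- s))"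
      by (rule decseq_SucI) (use assms in \<open>auto intro!: powr_mono2'\<close>)
    show "(\<lambda>k::nat. if k = 0 then 1 else real k powr (- s)) \<longlonglongrightarrow> 0"
    proof (rule Lim_transform_eventually)
      show "(\<lambda>k::nat. real k powr (- s)) \<longlonglongrightarrow> 0"
        using assms by (intro tendsto_neg_powr filterlim_real_sequentially) auto
      show "\<forall>\<^sub>F k::nat in sequentially. real k powr (- s) = (if k = 0 then 1 else real k powr (- s))"
        using eventually_gt_at_top[of 0] by eventually_elim simp
    qed
  qed
  moreover have "\<psi> (int k) * (if k = 0 then 1 else real k powr (- s)) = \<psi> (int k) * real k powr (- s)" for k by simp
  ultimately show ?thesis by simp
qed

text \<open>Convergence may be conditional, so the Euler factor is split off in partial sums of
  length \<open>N * p\<close>: the multiples of \<open>p\<close> there are the \<open>p * k\<close>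
  with \<open>k < N\<close>.\<close>

lemma real_L_remove_prime:
  assumes s: "0 < s" and p: "prime p" and \<phi>: "even_real_character m \<phi>"
    and eq: "\<And>k. \<psi> k = (if int p dvd k then 0 else \<phi> k)"
  shows "real_L s \<psi> = real_L s \<phi> * (1 - \<phi> (int p) * real p powr (- s))"
proof -
  interpret \<phi>: even_real_character m \<phi> by fact
  let ?a = "\<lambda>k. \<psi> (int k) * real k powr (- s)" and ?b = "\<lambda>k. \<phi> (int k) * real k powr (- s)"
  have p0: "0 < p" using p by (simp add: prime_gt_0_nat)
  have lim_b: "(\<lambda>N. \<Sum>k<N. ?b k) \<longlonglongrightarrow> real_L s \<phi>"
    unfolding real_L_def by (rule summable_LIMSEQ[OF \<phi>.summable_real_L[OF s]])
  have lim_a: "(\<lambda>N. \<Sum>k<N. ?a k) \<longlonglongrightarrow> real_L s \<psi>"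
    unfolding real_L_def by (rule summable_LIMSEQ[OF summable_real_L[OF s]])
  have sums: "(\<Sum>k<N * p. ?a k) = (\<Sum>k<N * p. ?b k) - \<phi> (int p) * real p powr (- s) * (\<Sum>k<N. ?b k)" for N
  proof -
    have "(\<Sum>k<N * p. ?b k) = (\<Sum>k\<in>{k\<in>{..<N * p}. p dvd k} \<union> {k\<in>{..<N * p}. \<not> p dvd k}. ?b k)"
      by (rule sum.cong) auto
    also have "\<dots> = (\<Sum>k\<in>{k\<in>{..<N * p}. p dvd k}. ?b k) + (\<Sum>k\<in>{k\<in>{..<N * p}. \<not> p dvd k}. ?b k)"
      by (rule sum.union_disjoint) auto
    also have "(\<Sum>k\<in>{k\<in>{..<N * p}. \<not> p dvd k}. ?b k) = (\<Sum>k<N * p. ?a k)"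
      by (rule sum.mono_neutral_cong_left) (auto simp: eq)
    also have "(\<Sum>k\<in>{k\<in>{..<N * p}. p dvd k}. ?b k) = (\<Sum>k<N. ?b (p * k))"
      by (rule sum.reindex_bij_witness[of _ "\<lambda>k. p * k" "\<lambda>k. k div p"])
         (use p0 in \<open>auto simp: mult.commute less_mult_imp_div_less\<close>)
    also have "\<dots> = \<phi> (int p) * real p powr (- s) * (\<Sum>k<N. ?b k)"
      by (simp add: sum_distrib_left \<phi>.mult powr_mult mult_ac)
    finally show ?thesis by simp
  qed
  have "(\<lambda>N. \<Sum>k<N * p. ?a k) \<longlonglongrightarrow> real_L s \<psi>" by (rule LIMSEQ_linear[OF lim_a p0])
  moreover have "(\<lambda>N. (\<Sum>k<N * p. ?b k) - \<phi> (int p) * real p powr (- s) * (\<Sum>k<N. ?b k)) \<longlonglongrightarrow>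
      real_L s \<phi> - \<phi> (int p) * real p powr (- s) * real_L s \<phi>"
    by (intro tendsto_diff tendsto_mult_left lim_b LIMSEQ_linear[OF lim_b p0])
  ultimately have "real_L s \<psi> = real_L s \<phi> - \<phi> (int p) * real p powr (- s) * real_L s \<phi>"
    unfolding sums by (rule LIMSEQ_unique)
  thus ?thesis by (simp add: algebra_simps)
qed

text \<open>Only one prime \<open>p\<close> of \<open>d / m0\<close> is removed at a time. As
  \<open>m0\<close> divides \<open>m = d / p\<close>, \<psi> on units depends only on the class
  modulo \<open>m\<close>, and \<phi> is read off from representatives coprime to
  \<open>d\<close>.\<close>

lemma imprimitive_reduction:
  assumes m0: "m0 dvd d" "m0 < d"
    and triv: "\<And>u. coprime u (int d) \<Longrightarrow> [u = 1] (mod int m0) \<Longrightarrow> \<psi> u = 1"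
  obtains p m \<phi> where "prime p" "m < d" "even_real_character m \<phi>"
    "\<forall>k. \<psi> k = (if int p dvd k then 0 else \<phi> k)"
proof -
  obtain t where t: "d = m0 * t" using m0 by auto
  have "t \<noteq> 1" using t m0 by auto
  then obtain p where p: "prime p" "p dvd t" using prime_factor_nat by blast
  then obtain t' where t': "t = p * t'" by auto
  define m where "m = m0 * t'"
  have dm: "d = p * m" using t t' by (simp add: m_def)
  have m_pos: "0 < m" using dm d_pos by auto
  have md: "m < d" using dm m_pos p prime_gt_1_nat[of p] by simp
  have cop_d: "coprime a (int d) \<longleftrightarrow> \<not> int p dvd a \<and> coprime a (int m)" for a
  proof -
    have "coprime a (int p) \<longleftrightarrow> \<not> int p dvd a"
      using p(1) by (metis coprime_commute coprime_absorb_left not_prime_unit prime_imp_coprime prime_nat_int_transfer)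
    thus ?thesis by (simp add: dm)
  qed
  \<comment> \<open>Multiply by an inverse \<open>v\<close> of \<open>b\<close>: then
    \<open>a * v\<close> is 1 modulo \<open>m0\<close>, where \<psi> is trivial.\<close>
  have wd: "\<psi> a = \<psi> b" if ab: "coprime a (int d)" "coprime b (int d)" "[a = b] (mod int m)" for a b
  proof -
    obtain v where v: "[b * v = 1] (mod int d)" using cong_solve_coprime_int[OF ab(2)] by blast
    have bv: "coprime (b * v) (int d)" using v by (metis cong_imp_coprime cong_sym coprime_1_left)
    hence cv: "coprime v (int d)" by simp
    have "[b * v = 1] (mod int m)" using v by (rule cong_dvd_modulus) (simp add: dm)
    moreover have "[a * v = b * v] (mod int m)" using ab(3) by (rule cong_scalar_right)
    ultimately have "[a * v = 1] (mod int m)" using cong_trans by blast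
    hence "[a * v = 1] (mod int m0)" by (rule cong_dvd_modulus) (simp add: m_def)
    moreover have "coprime (a * v) (int d)" using ab(1) cv by simp
    ultimately have "\<psi> (a * v) = 1" by (intro triv)
    moreover have "\<psi> (b * v) = 1" using psi_cong[OF v] by simp
    ultimately have "\<psi> a * \<psi> v = \<psi> b * \<psi> v" by (simp add: mult)
    moreover have "\<psi> v \<noteq> 0" using cv by (simp add: eq_0_iff)
    ultimately show ?thesis by simp
  qed
  \<comment> \<open>If \<open>p\<close> divides \<open>n\<close> and \<open>n\<close> is coprime to
    \<open>m\<close>, then \<open>p\<close> does not divide \<open>m\<close>, so
    \<open>n + m\<close> avoids \<open>p\<close> in the same class.\<close>
  define rep where "rep n = (if int p dvd n then n + int m else n)" for n :: int
  have rep_cong: "[rep n = n] (mod int m)" for n by (simp add: rep_def cong_iff_dvd_diff)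
  have rep_cop: "coprime (rep n) (int d)" if n: "coprime n (int m)" for n
  proof (cases "int p dvd n")
    case True
    hence "\<not> int p dvd int m" using n p(1) by (metis coprime_common_divisor not_prime_unit prime_nat_int_transfer)
    hence "\<not> int p dvd n + int m" using True by (simp add: dvd_add_right_iff)
    moreover have "coprime (n + int m) (int m)" using n by (simp only: coprime_iff_gcd_eq_1 gcd_add1)
    ultimately show ?thesis using True by (simp add: rep_def cop_d)
  next
    case False thus ?thesis using n by (simp add: rep_def cop_d)
  qed
  define \<phi> where "\<phi> n = (if coprime n (int m) then \<psi> (rep n) else 0)" for n
  have \<phi>_eq: "\<phi> n = \<psi> a" if "coprime a (int d)" "[a = n] (mod int m)" for a n
  proof -
    have "coprime a (int m)" using that(1) by (simp add: cop_d)
    hence c: "coprime n (int m)" using that(2) by (metis cong_imp_coprime)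
    moreover have "[rep n = a] (mod int m)" using rep_cong that(2) by (metis cong_sym cong_trans)
    ultimately show ?thesis using wd[OF rep_cop[OF c] that(1)] by (simp add: \<phi>_def)
  qed
  have "even_real_character m \<phi>"
  proof
    show "0 < m" by fact
    show "\<phi> (n + int m) = \<phi> n" for n
    proof (cases "coprime n (int m)")
      case True
      have "[n = n + int m] (mod int m)" by (simp add: cong_def)
      hence "[rep n = n + int m] (mod int m)" by (rule cong_trans[OF rep_cong])
      from \<phi>_eq[OF rep_cop[OF True] this] show ?thesis using True by (simp add: \<phi>_def)
    qed (simp add: \<phi>_def coprime_iff_gcd_eq_1)
    show "\<phi> (a * b) = \<phi> a * \<phi> b" for a b
    proof (cases "coprime a (int m) \<and> coprime b (int m)")
      case True
      have "[rep a * rep b = a * b] (mod int m)" using rep_cong by (intro cong_mult)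
      moreover have "coprime (rep a * rep b) (int d)" using True rep_cop by simp
      ultimately have "\<phi> (a * b) = \<psi> (rep a * rep b)" by (intro \<phi>_eq)
      thus ?thesis using True by (simp add: \<phi>_def mult)
    qed (auto simp: \<phi>_def)
    show "\<phi> n = 0 \<longleftrightarrow> \<not> coprime n (int m)" for n
      using rep_cop[of n] by (auto simp: \<phi>_def eq_0_iff)
    show "\<phi> (-1) = 1" using \<phi>_eq[of "-1" "-1"] even by simp
    obtain a where a: "coprime a (int d)" "\<psi> a \<noteq> 1" using nonprincipal by blast
    have "\<phi> a = \<psi> a" by (rule \<phi>_eq[OF a(1)]) simp
    thus "\<exists>a. coprime a (int m) \<and> \<phi> a \<noteq> 1" using a by (metis cop_d)
  qed
  moreover have "\<psi> k = (if int p dvd k then 0 else \<phi> k)" for k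
    using eq_0_iff[of k] by (auto simp: \<phi>_def rep_def cop_d)
  ultimately show ?thesis using that p(1) md by blast
qed

end

text \<open>Descent on the modulus: for \<open>s > 0\<close> the removed Euler factor is nonzero, so
  the zero passes to \<phi>.\<close>

lemma exists_primitive:
  assumes "even_real_character q \<psi>" "0 < s" "real_L s \<psi> = 0"
  shows "\<exists>d \<phi>. d \<le> q \<and> even_real_character d \<phi> \<and> real_L s \<phi> = 0 \<and>
    (\<forall>m. m dvd d \<longrightarrow> m < d \<longrightarrow> (\<exists>u. coprime u (int d) \<and> [u = 1] (mod int m) \<and> \<phi> u \<noteq> 1))"
  using assms
proof (induction q arbitrary: \<psi> rule: less_induct)
  case (less q)
  interpret even_real_character q \<psi> by (rule less.prems)
  show ?case
  proof (cases "\<forall>m. m dvd q \<longrightarrow> m < q \<longrightarrow> (\<exists>u. coprime u (int q) \<and> [u = 1] (mod int m) \<and> \<psi> u \<noteq> 1)")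
    case True
    thus ?thesis using less.prems by blast
  next
    case False
    then obtain m0 where "m0 dvd q" "m0 < q" "\<And>u. coprime u (int q) \<Longrightarrow> [u = 1] (mod int m0) \<Longrightarrow> \<psi> u = 1"
      by blast
    then obtain p m \<phi> where p: "prime p" "m < q" and \<phi>: "even_real_character m \<phi>"
      and eq: "\<forall>k. \<psi> k = (if int p dvd k then 0 else \<phi> k)"
      by (rule imprimitive_reduction) blast
    have "\<bar>\<phi> (int p) * real p powr (- s)\<bar> < 1"
    proof -
      have "real p powr (- s) < 1" using p less.prems(2) prime_gt_1_nat[of p] by (simp add: powr_less_one)
      moreover have "\<bar>\<phi> (int p)\<bar> \<le> 1" by (rule even_real_character.abs_psi_le_1[OF \<phi>])
      ultimately show ?thesis
        using mult_right_mono[of "\<bar>\<phi> (int p)\<bar>" 1 "real p powr (- s)"] by (simp add: abs_mult)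
    qed
    hence "real_L s \<phi> = 0"
      using real_L_remove_prime[OF less.prems(2) p(1) \<phi> eq[rule_format]] less.prems(3) by auto
    from less.IH[OF p(2) \<phi> less.prems(2) this] p(2) show ?thesis by (meson le_trans less_imp_le)
  qed
qed

section \<open>The zero-free interval\<close>

context primitive_even_real_character
begin

text \<open>The primitive modulus \<open>d\<close> may be small although \<open>q\<close> is large.
  Working with \<open>X \<ge> d\<close>, at least 400000, keeps the numerics uniform and still gives
  \<open>sqrt d \<le> m\<close>.\<close>

theorem zero_bound:
  assumes \<beta>: "0 < \<beta>" "\<beta> < 1" and zero: "real_L \<beta> \<psi> = 0"
    and X: "X = max 400000 (real d)"
  shows "100 / (sqrt X * (ln X)\<^sup>2) \<le> 1 - \<beta>"
proof (rule ccontr)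
  define \<delta> s l m where "\<delta> = 1 - \<beta>" and "s = sqrt X" and "l = ln X" and "m = nat \<lceil>s\<rceil>"
  assume "\<not> 100 / (sqrt X * (ln X)\<^sup>2) \<le> 1 - \<beta>"
  hence "\<delta> < 100 / (s * l\<^sup>2)" by (simp add: \<delta>_def s_def l_def)
  moreover have "0 < s * l\<^sup>2" using X by (simp add: s_def l_def)
  ultimately have \<delta>: "0 < \<delta>" "\<delta> * (s * l\<^sup>2) < 100" using \<beta> by (simp_all add: \<delta>_def pos_less_divide_eq)
  note K = pdiff_sum_bound[of X s l m \<delta>]
  have X4: "400000 \<le> X" "real d \<le> X" using X by auto
  have s: "632 \<le> s" unfolding s_def using X4 by (intro real_le_rsqrt) auto
  have sm: "s \<le> real m" unfolding m_def using s by linarith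
  have m5: "5 \<le> m" using sm s by linarith
  have w: "2 * (sqrt d / 2) \<le> real m"
    using sm real_sqrt_le_mono[OF X4(2)] unfolding s_def by linarith
  have "(\<Sum>k. \<psi> (int k) * pdiff \<delta> (real k)) = (\<Sum>k. \<psi> (int k) * real k powr (- \<beta>) - \<psi> (int k) / real k)"
  proof (rule arg_cong[where f = suminf], rule ext)
    fix k show "\<psi> (int k) * pdiff \<delta> (real k) = \<psi> (int k) * real k powr (- \<beta>) - \<psi> (int k) / real k"
      by (cases "k = 0") (simp_all add: pdiff_eq \<delta>_def right_diff_distrib divide_inverse)
  qed
  also have "\<dots> = real_L \<beta> \<psi> - L1"
    unfolding real_L_def L1_def by (rule suminf_diff[symmetric]) (intro summable_real_L \<beta> summable_L1)+
  finally have "\<bar>L1\<bar> = \<bar>\<Sum>k. \<psi> (int k) * pdiff \<delta> (real k)\<bar>" using zero by simp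
  also have "\<dots> \<le> (\<Sum>k=1..<m. pdiff \<delta> (real k)) + (35 / 2 - real m / 2) * pdiff \<delta> (real m)"
    by (rule convex_truncation_bound[OF _ abs_psi_le_1 abs_sum_psi_le abs_double_sum_le w m5 \<delta>(1)])
       (use K(2) X4 \<delta> in \<open>auto simp: s_def l_def m_def\<close>)
  also have "\<dots> \<le> \<delta> * (l\<^sup>2 / 8 - l / 4 + 11 / 5)"
    by (rule K(1)) (use X4 \<delta> in \<open>auto simp: s_def l_def m_def\<close>)
  finally have "\<bar>L1\<bar> * sqrt d \<le> \<delta> * (l\<^sup>2 / 8 - l / 4 + 11 / 5) * sqrt d" by (rule mult_right_mono) simp
  also have "\<dots> < ln (real d - 3)"
    by (rule numeric_contradiction[OF _ X s_def l_def \<delta>]) (use d_ge_5 in simp)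
  finally show False using L1_lower_bound by (simp add: mult.commute)
qed

end

theorem theorem1p3:
  fixes q :: nat and chi :: "int \<Rightarrow> complex" and \<beta>\<^sub>0 :: real
  assumes "q > 4 * 10 ^ 5"
    and "dirichlet_character q chi"
    and "even_character chi"
    and "chi \<noteq> principal_character q"
    and "real_character chi"
    and "0 < \<beta>\<^sub>0" and "\<beta>\<^sub>0 < 1"
    and "dirichlet_L (complex_of_real \<beta>\<^sub>0) chi = 0"
  shows "\<beta>\<^sub>0 \<le> 1 - 100 / (sqrt (real q) * (ln (real q))\<^sup>2)"
proof -
  define \<psi> where "\<psi> = (\<lambda>n. Re (chi n))"
  have chi: "chi n = of_real (\<psi> n)" for n
    using assms(5) by (simp add: real_character_def \<psi>_def complex_is_Real_iff complex_eq_iff)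
  note dc = assms(2)[unfolded dirichlet_character_def]
  have ev: "even_real_character q \<psi>"
  proof
    show "0 < q" using dc by simp
    show "\<psi> (n + int q) = \<psi> n" for n using dc by (simp add: \<psi>_def)
    show "\<psi> (m * n) = \<psi> m * \<psi> n" for m n
    proof -
      have "complex_of_real (\<psi> (m * n)) = of_real (\<psi> m * \<psi> n)" using dc by (simp flip: chi)
      thus ?thesis by (simp only: of_real_eq_iff)
    qed
    show "\<psi> n = 0 \<longleftrightarrow> \<not> coprime n (int q)" for n using dc chi[of n] by (metis of_real_eq_0_iff)
    show "\<psi> (-1) = 1" using assms(3) by (simp add: even_character_def \<psi>_def)
    obtain a where a: "chi a \<noteq> principal_character q a" using assms(4) by blast
    hence "coprime a (int q)" using dc by (metis principal_character_def)
    thus "\<exists>a. coprime a (int q) \<and> \<psi> a \<noteq> 1"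
      using a chi[of a] by (auto simp: principal_character_def)
  qed
  then interpret \<psi>: even_real_character q \<psi> .
  have "real_L \<beta>\<^sub>0 \<psi> = 0"
  proof -
    have S: "summable (\<lambda>k. \<psi> (int k) * real k powr (- \<beta>\<^sub>0))" by (rule \<psi>.summable_real_L) fact
    have "dirichlet_L (of_real \<beta>\<^sub>0) chi = (\<Sum>k. of_real (\<psi> (int (Suc k)) * real (Suc k) powr (- \<beta>\<^sub>0)))"
      unfolding dirichlet_L_def
    proof (rule arg_cong[where f = suminf], rule ext)
      fix k
      have "of_nat (Suc k) powr (- complex_of_real \<beta>\<^sub>0) = of_real (real (Suc k) powr (- \<beta>\<^sub>0))"
        using powr_of_real[of "real (Suc k)" "- \<beta>\<^sub>0"] by simp
      thus "chi (int (Suc k)) * of_nat (Suc k) powr (- complex_of_real \<beta>\<^sub>0) =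
          of_real (\<psi> (int (Suc k)) * real (Suc k) powr (- \<beta>\<^sub>0))"
        by (simp only: chi of_real_mult)
    qed
    also have "\<dots> = of_real (\<Sum>k. \<psi> (int (Suc k)) * real (Suc k) powr (- \<beta>\<^sub>0))"
      using S by (intro suminf_of_real[symmetric]) (subst summable_Suc_iff)
    also have "(\<Sum>k. \<psi> (int (Suc k)) * real (Suc k) powr (- \<beta>\<^sub>0)) = real_L \<beta>\<^sub>0 \<psi>"
      unfolding real_L_def using suminf_split_head[OF S] by simp
    finally show ?thesis using assms(8) by simp
  qed
  from exists_primitive[OF ev assms(6) this] obtain d \<phi> where
    d: "d \<le> q" "even_real_character d \<phi>" "real_L \<beta>\<^sub>0 \<phi> = 0"
      "\<forall>m. m dvd d \<longrightarrow> m < d \<longrightarrow> (\<exists>u. coprime u (int d) \<and> [u = 1] (mod int m) \<and> \<phi> u \<noteq> 1)"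
    by blast
  interpret \<phi>: primitive_even_real_character d \<phi>
    using d by (intro primitive_even_real_character.intro primitive_even_real_character_axioms.intro) auto
  \<comment> \<open>Both entries are at most \<open>q\<close>, and the claimed distance from 1
    decreases in the modulus, so the bound for \<open>X\<close> implies the one for
    \<open>q\<close>.\<close>
  define X where "X = max 400000 (real d)"
  have X: "400000 \<le> X" "X \<le> real q" using d(1) assms(1) by (auto simp: X_def)
  have "100 / (sqrt (real q) * (ln (real q))\<^sup>2) \<le> 100 / (sqrt X * (ln X)\<^sup>2)"
    using X by (intro divide_left_mono mult_mono power_mono mult_pos_pos) auto
  also have "\<dots> \<le> 1 - \<beta>\<^sub>0" by (rule \<phi>.zero_bound[OF assms(6,7) d(3) X_def])
  finally show ?thesis by simp
qed

end
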